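(* Let $p\in(0,\infty)$ and $r\in[1,\infty)$ be such that $\max\{p,r\}>1$, let $s\in\mathbb R$, and let $\mathfrak X:=\ell^u(\mathbb Z)$ for some $u\in[1,\infty)$. Then there exists a weight $V\in\mathscr A_{\max\{p,r\}}(\mathbb R;\mathscr L(\mathfrak X))$ for which there is no finite constant $C$ such that $$\|t\|_{\dot f^s_{p,\infty}(V)}\le C\,\|t\|_{\dot f^s_{p,\infty}(\rho^V_r)}$$ holds for all sequences $t=\{t_Q\}_{Q\in\mathscr D}$ of vectors in $\mathfrak X$.
   Context: Here the underlying Euclidean space is $\mathbb R$ and $\mathscr D=\bigcup_{j\in\mathbb Z}\mathscr D_j$, $\mathscr D_j=\{2^{-j}[k,k+1):k\in\mathbb Z\}$, are the dyadic intervals. Weights. $f:\mathbb R\to\mathfrak X$ is strongly measurable if it is a pointwise limit of simple functions. $V:\mathbb R\to\mathscr L(\mathfrak X)$ (bounded linear operators on $\mathfrak X$) is a weight if $V(\cdot)\mathfrak e$ and $V(\cdot)^{-1}\mathfrak e$ are strongly measurable for every $\mathfrak e\in\mathfrak X$ and $V(x)$ is invertible for a.e. $x$. It is a $w$-weight if moreover $\mathbf 1_QV(\cdot)\mathfrak e\in L^w(\mathbb R;\mathfrak X)$ for all bounded intervals $Q$ and all $\mathfrak e$. $V^{-*}(x):=(V(x)^{-1})^*\in\mathscr L(\mathfrak X^* )$, to which the same notions apply with $\mathfrak X^*$ in place of $\mathfrak X$. $\rho^V_{w,Q}(\mathfrak e):=\big(\frac1{|Q|}\int_Q\|V(x)\mathfrak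 e\|^w\,dx\big)^{1/w}$, similarly $\rho^{V^{-*}}_{w,Q}(\mathfrak e^* )$; $\rho^*(\mathfrak e^* ):=\sup_{\mathfrak e\ne0}|\langle\mathfrak e^*,\mathfrak e\rangle|/\rho(\mathfrak e)$. $\mathscr A_w$ condition for $w\in(1,\infty)$, $w'=w/(w-1)$: $V\in\mathscr A_w(\mathbb R;\mathscr L(\mathfrak X))$ means that $V$ is a $w$-weight, $V^{-*}$ is a $w'$-weight, and there is a finite $C$ with $\rho^{V^{-*}}_{w',Q}(\mathfrak e^* )\le C(\rho^V_{w,Q})^*(\mathfrak e^* )$ for all bounded intervals $Q$ and all $\mathfrak e^*\in\mathfrak X^*$. Sequence quasi-norms. For $t=\{t_Q\}_{Q\in\mathscr D}$ let $t_j:=\sum_{Q\in\mathscr D_j}t_Q|Q|^{-1/2}\mathbf 1_Q$. Then $$\|t\|_{\dot f^s_{p,\infty}(V)}:=\Big\|\sup_{j\in\mathbb Z}2^{js}\|V(\cdot)t_j(\cdot)\|_{\mathfrak X}\Big\|_{L^p(\mathbb R)},\qquad \|t\|_{\dot f^s_{p,\infty}(\rho^V_r)}:=\Big\|\sup_{j\in\mathbb Z}2^{js}\sum_{Q\in\mathscr D_j}\rho^V_{r,Q}(t_Q)|Q|^{-1/2}\mathbf 1_Q\Big\|_{L^p(\mathbb R)}.$$ *)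

theory Defs
  imports "HOL-Analysis.Analysis"
begin

text \<open>
  A type cannot depend on the real exponent \<open>u\<close>, so normed spaces are given by explicit carriers:
  a space consists of scalar-valued functions on an index type \<open>'i\<close>, with pointwise vector operations.
  This covers both \<open>\<ell>\<^sup>u(\<int>)\<close> (\<open>'i = int\<close>) and its dual (\<open>'i = int \<Rightarrow> 'k\<close>, functionals on \<open>\<ell>\<^sup>u(\<int>)\<close>).
  Operators and functionals matter only through their values on the carrier.
\<close>

record ('i, 'k) fspace =
  vecs :: "('i \<Rightarrow> 'k) set"
  nrm :: "('i \<Rightarrow> 'k) \<Rightarrow> real"

definition ell :: "real \<Rightarrow> (int, 'k::real_normed_field) fspace" where
  "ell u = \<lparr> vecs = {x. (\<lambda>k. norm (x k) powr u) summable_on UNIV},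
             nrm = (\<lambda>x. (\<Sum>\<^sub>\<infinity>k. norm (x k) powr u) powr (1 / u)) \<rparr>"

definition bounded_op ::
    "('i, 'k::real_normed_field) fspace \<Rightarrow> (('i \<Rightarrow> 'k) \<Rightarrow> ('i \<Rightarrow> 'k)) \<Rightarrow> bool" where
  "bounded_op X A \<longleftrightarrow>
     (\<forall>x\<in>vecs X. A x \<in> vecs X) \<and>
     (\<forall>x\<in>vecs X. \<forall>y\<in>vecs X. A (\<lambda>i. x i + y i) = (\<lambda>i. A x i + A y i)) \<and>
     (\<forall>c. \<forall>x\<in>vecs X. A (\<lambda>i. c * x i) = (\<lambda>i. c * A x i)) \<and>
     (\<exists>K. \<forall>x\<in>vecs X. nrm X (A x) \<le> K * nrm X x)"

definition bounded_functional ::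
    "('i, 'k::real_normed_field) fspace \<Rightarrow> (('i \<Rightarrow> 'k) \<Rightarrow> 'k) \<Rightarrow> bool" where
  "bounded_functional X \<phi> \<longleftrightarrow>
     (\<forall>x\<in>vecs X. \<forall>y\<in>vecs X. \<phi> (\<lambda>i. x i + y i) = \<phi> x + \<phi> y) \<and>
     (\<forall>c. \<forall>x\<in>vecs X. \<phi> (\<lambda>i. c * x i) = c * \<phi> x) \<and>
     (\<exists>K. \<forall>x\<in>vecs X. norm (\<phi> x) \<le> K * nrm X x)"

text \<open>Functionals vanish off the carrier, so that equal functionals are equal functions.\<close>

definition dual :: "('i, 'k::real_normed_field) fspace \<Rightarrow> ('i \<Rightarrow> 'k, 'k) fspace" where
  "dual X = \<lparr> vecs = {\<phi>. bounded_functional X \<phi> \<and> (\<forall>x. x \<notin> vecs X \<longrightarrow> \<phi> x = 0)},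
              nrm = (\<lambda>\<phi>. SUP x\<in>{x\<in>vecs X. nrm X x \<le> 1}. norm (\<phi> x)) \<rparr>"

definition adj ::
    "('i, 'k::real_normed_field) fspace \<Rightarrow> (('i \<Rightarrow> 'k) \<Rightarrow> ('i \<Rightarrow> 'k))
      \<Rightarrow> (('i \<Rightarrow> 'k) \<Rightarrow> 'k) \<Rightarrow> (('i \<Rightarrow> 'k) \<Rightarrow> 'k)" where
  "adj X A \<phi> = (\<lambda>x. if x \<in> vecs X then \<phi> (A x) else 0)"

definition invertible_op ::
    "('i, 'k::real_normed_field) fspace \<Rightarrow> (('i \<Rightarrow> 'k) \<Rightarrow> ('i \<Rightarrow> 'k)) \<Rightarrow> bool" where
  "invertible_op X A \<longleftrightarrow>
     bounded_op X A \<and> (\<exists>B. bounded_op X B \<and> (\<forall>x\<in>vecs X. B (A x) = x \<and> A (B x) = x))"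

text \<open>The inverse of a weight is only defined almost everywhere; it is extended by the zero operator.\<close>

definition inv_op ::
    "('i, 'k::real_normed_field) fspace \<Rightarrow> (('i \<Rightarrow> 'k) \<Rightarrow> ('i \<Rightarrow> 'k)) \<Rightarrow> (('i \<Rightarrow> 'k) \<Rightarrow> ('i \<Rightarrow> 'k))" where
  "inv_op X A = (if invertible_op X A then inv_into (vecs X) A else (\<lambda>_ _. 0))"

definition strongly_measurable ::
    "('i, 'k::real_normed_field) fspace \<Rightarrow> (real \<Rightarrow> ('i \<Rightarrow> 'k)) \<Rightarrow> bool" where
  "strongly_measurable X f \<longleftrightarrow>
     range f \<subseteq> vecs X \<and>
     (\<exists>F. (\<forall>n::nat. simple_function lebesgue (F n) \<and> range (F n) \<subseteq> vecs X) \<and>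
          (\<forall>x. (\<lambda>n. nrm X (\<lambda>i. F n x i - f x i)) \<longlonglongrightarrow> 0))"

text \<open>Powers with exponent \<open>a > 0\<close>, with \<open>\<infinity>\<^sup>a = \<infinity>\<close>.\<close>

definition epowr :: "ennreal \<Rightarrow> real \<Rightarrow> ennreal" where
  "epowr z a = (if z = \<infinity> then \<infinity> else ennreal (enn2real z powr a))"

definition Lp_qnorm :: "real \<Rightarrow> (real \<Rightarrow> ennreal) \<Rightarrow> ennreal" where
  "Lp_qnorm p f = epowr (\<integral>\<^sup>+x. epowr (f x) p \<partial>lebesgue) (1 / p)"

definition in_Lp ::
    "('i, 'k::real_normed_field) fspace \<Rightarrow> real \<Rightarrow> (real \<Rightarrow> ('i \<Rightarrow> 'k)) \<Rightarrow> bool" where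
  "in_Lp X p f \<longleftrightarrow> strongly_measurable X f \<and> Lp_qnorm p (\<lambda>x. ennreal (nrm X (f x))) < \<infinity>"

definition bounded_interval :: "real set \<Rightarrow> bool" where
  "bounded_interval Q \<longleftrightarrow> is_interval Q \<and> bounded Q \<and> interior Q \<noteq> {}"

type_synonym ('i, 'k) op_field = "real \<Rightarrow> ('i \<Rightarrow> 'k) \<Rightarrow> ('i \<Rightarrow> 'k)"

definition weight ::
    "('i, 'k::real_normed_field) fspace \<Rightarrow> ('i, 'k) op_field \<Rightarrow> bool" where
  "weight X V \<longleftrightarrow>
     (\<forall>x. bounded_op X (V x)) \<and>
     (\<forall>e\<in>vecs X. strongly_measurable X (\<lambda>x. V x e) \<and>
                  strongly_measurable X (\<lambda>x. inv_op X (V x) e)) \<and>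
     (AE x in lebesgue. invertible_op X (V x))"

definition w_weight ::
    "('i, 'k::real_normed_field) fspace \<Rightarrow> real \<Rightarrow> ('i, 'k) op_field \<Rightarrow> bool" where
  "w_weight X w V \<longleftrightarrow>
     weight X V \<and>
     (\<forall>Q. bounded_interval Q \<longrightarrow>
        (\<forall>e\<in>vecs X. in_Lp X w (\<lambda>x. if x \<in> Q then V x e else (\<lambda>_. 0))))"

definition rho ::
    "('i, 'k::real_normed_field) fspace \<Rightarrow> ('i, 'k) op_field \<Rightarrow> real \<Rightarrow> real set \<Rightarrow> ('i \<Rightarrow> 'k) \<Rightarrow> ennreal" where
  "rho X V w Q e =
     epowr ((\<integral>\<^sup>+x. ennreal (nrm X (V x e) powr w) * indicator Q x \<partial>lebesgue) / emeasure lebesgue Q) (1 / w)"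

definition dual_rho ::
    "('i, 'k::real_normed_field) fspace \<Rightarrow> (('i \<Rightarrow> 'k) \<Rightarrow> ennreal) \<Rightarrow> (('i \<Rightarrow> 'k) \<Rightarrow> 'k) \<Rightarrow> ennreal" where
  "dual_rho X \<rho> \<phi> = (SUP e\<in>vecs X - {\<lambda>_. 0}. ennreal (norm (\<phi> e)) / \<rho> e)"

definition inv_adj ::
    "('i, 'k::real_normed_field) fspace \<Rightarrow> ('i, 'k) op_field \<Rightarrow> ('i \<Rightarrow> 'k, 'k) op_field" where
  "inv_adj X V = (\<lambda>x. adj X (inv_op X (V x)))"

definition A_class ::
    "('i, 'k::real_normed_field) fspace \<Rightarrow> real \<Rightarrow> ('i, 'k) op_field \<Rightarrow> bool" where
  "A_class X w V \<longleftrightarrow>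
     (let w' = w / (w - 1) in
       w_weight X w V \<and> w_weight (dual X) w' (inv_adj X V) \<and>
       (\<exists>C::real. \<forall>Q. bounded_interval Q \<longrightarrow>
          (\<forall>\<phi>\<in>vecs (dual X).
             rho (dual X) (inv_adj X V) w' Q \<phi> \<le> ennreal C * dual_rho X (rho X V w Q) \<phi>)))"

definition dyadic :: "int \<Rightarrow> real set set" where
  "dyadic j = range (\<lambda>k::int. {2 powi (- j) * of_int k ..< 2 powi (- j) * (of_int k + 1)})"

definition level ::
    "(real set \<Rightarrow> 'i \<Rightarrow> 'k::real_normed_field) \<Rightarrow> int \<Rightarrow> real \<Rightarrow> ('i \<Rightarrow> 'k)" where
  "level t j x =
     (\<lambda>i. \<Sum>\<^sub>\<infinity>Q\<in>dyadic j. t Q i * of_real (measure lebesgue Q powr (- 1 / 2) * indicator Q x))"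

definition f_norm_weight ::
    "('i, 'k::real_normed_field) fspace \<Rightarrow> real \<Rightarrow> real \<Rightarrow> ('i, 'k) op_field
      \<Rightarrow> (real set \<Rightarrow> 'i \<Rightarrow> 'k) \<Rightarrow> ennreal" where
  "f_norm_weight X p s V t =
     Lp_qnorm p (\<lambda>x. SUP j::int. ennreal (2 powr (of_int j * s)) * ennreal (nrm X (V x (level t j x))))"

definition f_norm_average ::
    "('i, 'k::real_normed_field) fspace \<Rightarrow> real \<Rightarrow> real \<Rightarrow> (real set \<Rightarrow> ('i \<Rightarrow> 'k) \<Rightarrow> ennreal)
      \<Rightarrow> (real set \<Rightarrow> 'i \<Rightarrow> 'k) \<Rightarrow> ennreal" where
  "f_norm_average X p s \<rho> t =
     Lp_qnorm p (\<lambda>x. SUP j::int. ennreal (2 powr (of_int j * s)) *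
       (\<Sum>\<^sub>\<infinity>Q\<in>dyadic j. \<rho> Q (t Q) * ennreal (measure lebesgue Q powr (- 1 / 2)) * indicator Q x))"

end

theory Submission
  imports Defs
begin

text \<open>
  The weight is diagonal, \<open>V(x) e\<^sub>k = v\<^sub>k(x) e\<^sub>k\<close>, where \<open>v\<^sub>k\<^sup>m\<close>, for
  \<open>m = max u (max p r)\<close>, behaves like \<open>\<bar>x - a\<bar>\<close> to the power \<open>-1/2\<close> near each pole
  \<open>a = n + sqrt \<bar>k\<bar>\<close>, \<open>n \<ge> \<bar>k\<bar>\<close>, and equals 1 far from the poles. These scalar weights satisfy the
  \<open>A\<^sub>1\<close> condition uniformly in \<open>k\<close>, and this gives \<open>\<rho>(e) \<le> C \<parallel>V(x) e\<parallel>\<close> for almost every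
  \<open>x \<in> Q\<close>, hence the operator-valued \<open>A\<close> condition. On a bounded set only finitely many
  \<open>v\<^sub>k\<close> differ from 1, so that each \<open>V(x)\<close> is bounded and \<open>V\<^sup>-\<^sup>*\<close> is strongly measurable even
  when the dual space is not separable.

  Each \<open>v\<^sub>k\<close> has bounded averages over intervals of length at least 1, but the poles become dense modulo 1
  as \<open>k\<close> varies, so that \<open>sup\<^sub>k v\<^sub>k\<close> is large everywhere far to the right. A sequence which
  at scale \<open>2\<^sup>k\<close> only uses the coordinate \<open>e\<^sub>k\<close> then has a bounded averaged norm, while its
  weighted norm sees \<open>sup\<^sub>k v\<^sub>k\<close>.
\<close>

subsection \<open>Scalar weights with square-root singularities\<close>

lemma bounded_interval_lmeasurable:
  assumes "bounded_interval Q"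
  shows "Q \<in> lmeasurable"
  using assms by (auto simp: bounded_interval_def is_interval_convex_1 intro: measurable_convex)

lemma bounded_interval_measure_pos:
  assumes "bounded_interval Q"
  shows "measure lebesgue Q > 0"
proof -
  obtain x e where "e > 0" "cball x e \<subseteq> Q"
    using assms unfolding bounded_interval_def
    by (meson all_not_in_conv interior_subset open_contains_cball open_interior subset_trans)
  moreover have "measure lebesgue (cball x e) \<le> measure lebesgue Q"
    using \<open>cball x e \<subseteq> Q\<close> bounded_interval_lmeasurable[OF assms]
    by (intro measure_mono_fmeasurable) auto
  moreover have "measure lebesgue (cball x e) = 2 * e"
    using \<open>e > 0\<close> by (simp add: cball_eq_atLeastAtMost)
  ultimately show ?thesis by linarith
qed

lemma bounded_interval_dist_le:
  assumes "bounded_interval Q" "x \<in> Q" "y \<in> Q"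
  shows "\<bar>x - y\<bar> \<le> measure lebesgue Q"
proof -
  have *: "b - a \<le> measure lebesgue Q" if "a \<in> Q" "b \<in> Q" "a \<le> b" for a b
  proof -
    have "{a..b} \<subseteq> Q"
      using assms(1) that unfolding bounded_interval_def is_interval_1
      by (meson atLeastAtMost_iff subsetI)
    then have "measure lebesgue {a..b} \<le> measure lebesgue Q"
      using bounded_interval_lmeasurable[OF assms(1)] by (intro measure_mono_fmeasurable) auto
    then show ?thesis using that by simp
  qed
  show ?thesis using *[OF assms(2,3)] *[OF assms(3,2)] by linarith
qed

lemma bounded_interval_emeasure:
  assumes "bounded_interval Q"
  shows "emeasure lebesgue Q = ennreal (measure lebesgue Q)"
  using bounded_interval_lmeasurable[OF assms] by (simp add: emeasure_eq_measure2)

text \<open>On the two sides of \<open>a\<close>, antiderivatives are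
  \<open>sqrt (2 * (y - a))\<close> and \<open>- sqrt (2 * (a - y))\<close>. They are continuous up
  to the singularity, so the fundamental theorem applies with differentiability in the interior
  only.\<close>

lemma nn_integral_inverse_sqrt:
  fixes a c :: real
  assumes "c > 0"
  shows "(\<integral>\<^sup>+y. ennreal ((2 * \<bar>y - a\<bar>) powr (- (1/2))) * indicator {a - c..a + c} y \<partial>lebesgue)
         = ennreal (2 * sqrt (2 * c))"
proof -
  let ?f = "\<lambda>y. (2 * \<bar>y - a\<bar>) powr (- (1/2))"
  have "(?f has_integral (sqrt (2 * (a + c - a)) - sqrt (2 * (a - a)))) {a..a + c}"
    using assms
    by (intro fundamental_theorem_of_calculus_interior)
       (auto intro!: continuous_intros derivative_eq_intros
             simp: has_real_derivative_iff_has_vector_derivative[symmetric] powr_minus powr_half_sqrt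
                   field_simps)
  moreover have "(?f has_integral (- sqrt (2 * (a - a)) - (- sqrt (2 * (a - (a - c)))))) {a - c..a}"
    using assms
    by (intro fundamental_theorem_of_calculus_interior)
       (auto intro!: continuous_intros derivative_eq_intros
             simp: has_real_derivative_iff_has_vector_derivative[symmetric] powr_minus powr_half_sqrt
                   field_simps abs_if)
  ultimately have "(?f has_integral (sqrt (2 * c) + sqrt (2 * c))) {a - c..a + c}"
    using assms by (intro has_integral_combine[of "a - c" a "a + c"]) auto
  then have "integral\<^sup>N lborel (\<lambda>x. indicator {a - c..a + c} x * ?f x)
      = ennreal (sqrt (2 * c) + sqrt (2 * c))"
    by (intro nn_integral_has_integral_lebesgue) auto
  then show ?thesis
    by (simp add: nn_integral_completion ennreal_mult' ennreal_indicator mult.commute)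
qed

lemma borel_measurable_inverse_sqrt:
  fixes a c :: real
  shows "(\<lambda>y. ennreal ((2 * \<bar>y - a\<bar>) powr (- (1/2))) * indicator {a - c..a + c} y)
    \<in> borel_measurable lebesgue"
  by (rule measurable_completion) measurable

text \<open>For fixed \<open>K\<close> the poles are spaced by 1. Starting at \<open>n = K\<close>
  moves all of them into [K, \<infinity>), so that a bounded set meets the poles of finitely many
  \<open>K\<close> only.\<close>

definition poles :: "nat \<Rightarrow> real set" where
  "poles K = (\<lambda>n. real n + sqrt (real K)) ` {K..}"

text \<open>The factor 2 makes the power equal to 1 at distance 1/2 from the poles, which is half
  their spacing. As \<open>0 powr (- (1/2)) = 0\<close>, the value at a pole is 1 and not
  infinite.\<close>

definition bump :: "nat \<Rightarrow> real \<Rightarrow> real" where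
  "bump K x = max 1 ((2 * infdist x (poles K)) powr (- (1/2)))"

lemma countable_poles: "countable (poles K)"
  by (simp add: poles_def)

text \<open>The poles are a translate of a set of natural numbers, hence closed, and the distance to
  a nonempty closed set is attained.\<close>

lemma nearest_pole:
  obtains a where "a \<in> poles K" "infdist x (poles K) = \<bar>x - a\<bar>"
proof -
  have "poles K = (\<lambda>y. sqrt (real K) + y) ` (of_nat ` {K..})"
    by (auto simp: poles_def image_image add.commute)
  then have "closed (poles K)"
    by (metis closed_of_nat_image closed_translation)
  moreover have "poles K \<noteq> {}" by (auto simp: poles_def)
  ultimately show ?thesis
    using infdist_attains_inf that by (metis dist_real_def)
qed

lemma poles_separated:
  assumes "a \<in> poles K" "b \<in> poles K" "a \<noteq> b"
  shows "\<bar>a - b\<bar> \<ge> 1"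
  using assms by (auto simp: poles_def)

lemma bump_ge_1: "bump K x \<ge> 1"
  by (simp add: bump_def)

lemma bump_pos: "bump K x > 0"
  using bump_ge_1[of K x] by linarith

lemma inverse_sqrt_le_1: "(2 * \<bar>d\<bar>) powr (- (1/2)) \<le> 1" if "\<bar>d\<bar> \<ge> 1/2" for d :: real
  using powr_mono2'[of "-(1/2)" 1 "(2 * \<bar>d\<bar>)"] that by auto

lemma bump_eq_1:
  assumes "x < real K - 1/2"
  shows "bump K x = 1"
proof -
  obtain a where a: "a \<in> poles K" "infdist x (poles K) = \<bar>x - a\<bar>"
    by (rule nearest_pole)
  have "a \<ge> real K" using a(1) by (auto simp: poles_def add_increasing2)
  then have "\<bar>x - a\<bar> \<ge> 1/2" using assms by linarith
  then show ?thesis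
    using inverse_sqrt_le_1[of "x - a"] by (simp add: bump_def a)
qed

lemma borel_measurable_bump [measurable]: "bump K \<in> borel_measurable borel"
proof -
  have "continuous_on UNIV (\<lambda>x. infdist x (poles K))" by (intro continuous_intros)
  then have [measurable]: "(\<lambda>x. infdist x (poles K)) \<in> borel_measurable borel"
    by (rule borel_measurable_continuous_onI)
  show ?thesis unfolding bump_def[abs_def] by measurable
qed

text \<open>The nearest pole is no farther away than \<open>a\<close>, and the negative exponent
  reverses the order of the two distances.\<close>

lemma bump_ge_pole:
  assumes "a \<in> poles K" "x \<notin> poles K"
  shows "bump K x \<ge> (2 * \<bar>x - a\<bar>) powr (- (1/2))"
proof -
  obtain b where b: "b \<in> poles K" "infdist x (poles K) = \<bar>x - b\<bar>"
    by (rule nearest_pole)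
  have "\<bar>x - b\<bar> \<le> \<bar>x - a\<bar>"
    using infdist_le[OF assms(1), of x] b by (simp add: dist_real_def)
  moreover have "\<bar>x - b\<bar> > 0" using b assms by auto
  ultimately have "(2 * \<bar>x - a\<bar>) powr (- (1/2)) \<le> (2 * \<bar>x - b\<bar>) powr (- (1/2))"
    by (intro powr_mono2') auto
  then show ?thesis by (simp add: bump_def b)
qed

text \<open>At most 2l + 2 singularities lie within 1/2 of an interval of length l. Each contributes
  an integral 2, and elsewhere \<open>bump\<close> is 1. The total 5l + 4 is at most 25l because l
  \<ge> 1/4.\<close>

lemma nn_integral_bump_le_long:
  assumes Q: "bounded_interval Q" and long: "measure lebesgue Q \<ge> 1/4"
  shows "(\<integral>\<^sup>+y. ennreal (bump K y) * indicator Q y \<partial>lebesgue) \<le> ennreal (25 * measure lebesgue Q)"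
proof -
  define l where "l = measure lebesgue Q"
  have [measurable]: "Q \<in> sets lebesgue" using bounded_interval_lmeasurable[OF Q] by auto
  obtain x where x: "x \<in> Q" using Q interior_subset by (fastforce simp: bounded_interval_def)
  define N where "N = {n::int. \<bar>real_of_int n - (x - sqrt K)\<bar> \<le> l + 1/2}"
  have N_eq: "N = {\<lceil>x - sqrt K - l - 1/2\<rceil>..\<lfloor>x - sqrt K + l + 1/2\<rfloor>}"
    unfolding N_def by (auto simp: ceiling_le_iff le_floor_iff abs_le_iff)
  then have finN: "finite N" by simp
  have cardN: "real (card N) \<le> 2 * l + 2"
  proof -
    have "real_of_int (\<lfloor>x - sqrt K + l + 1/2\<rfloor> - \<lceil>x - sqrt K - l - 1/2\<rceil> + 1) \<le> 2 * l + 2"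
      by linarith
    moreover have "l \<ge> 0" by (simp add: l_def)
    ultimately show ?thesis unfolding N_eq by simp
  qed
  let ?h = "\<lambda>n y. (2 * \<bar>y - (real_of_int n + sqrt K)\<bar>) powr (- (1/2))"
  let ?J = "\<lambda>n::int. {real_of_int n + sqrt K - 1/2..real_of_int n + sqrt K + 1/2}"
  have "ennreal (bump K y) * indicator Q y
      \<le> indicator Q y + (\<Sum>n\<in>N. ennreal (?h n y) * indicator (?J n) y)" for y
  proof (cases "y \<in> Q")
    case True
    obtain a where a: "a \<in> poles K" "infdist y (poles K) = \<bar>y - a\<bar>"
      by (rule nearest_pole)
    then obtain n :: nat where n: "a = real n + sqrt K" by (auto simp: poles_def)
    show ?thesis
    proof (cases "\<bar>y - a\<bar> \<le> 1/2")
      case close: True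
      have "\<bar>y - x\<bar> \<le> l" unfolding l_def by (rule bounded_interval_dist_le[OF Q True x])
      then have "int n \<in> N" using close unfolding N_def n mem_Collect_eq of_int_of_nat_eq abs_le_iff by auto
      then have "ennreal (?h (int n) y) * indicator (?J (int n)) y
          \<le> (\<Sum>n\<in>N. ennreal (?h n y) * indicator (?J n) y)"
        using finN by (intro member_le_sum) auto
      moreover have "y \<in> ?J (int n)" using close unfolding n by (simp only: atLeastAtMost_iff abs_le_iff) linarith
      moreover have "bump K y \<le> 1 + ?h (int n) y"
        by (simp add: bump_def a n)
      then have "ennreal (bump K y) \<le> 1 + ennreal (?h (int n) y)"
        by (metis ennreal_1 ennreal_leI ennreal_plus powr_ge_zero zero_le_one)
      ultimately show ?thesis using True by (auto intro: order_trans add_left_mono)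
    next
      case False
      then have "bump K y = 1"
        using inverse_sqrt_le_1[of "y - a"] by (simp add: bump_def a)
      then show ?thesis using True by simp
    qed
  qed simp
  then have "(\<integral>\<^sup>+y. ennreal (bump K y) * indicator Q y \<partial>lebesgue)
      \<le> (\<integral>\<^sup>+y. indicator Q y + (\<Sum>n\<in>N. ennreal (?h n y) * indicator (?J n) y) \<partial>lebesgue)"
    by (intro nn_integral_mono)
  also have "\<dots> = emeasure lebesgue Q + (\<Sum>n\<in>N. \<integral>\<^sup>+y. ennreal (?h n y) * indicator (?J n) y \<partial>lebesgue)"
    by (subst nn_integral_add nn_integral_sum,
        auto intro!: borel_measurable_inverse_sqrt borel_measurable_sum nn_integral_sum)
  also have "\<dots> = ennreal l + (\<Sum>n\<in>N. ennreal 2)"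
    by (subst nn_integral_inverse_sqrt) (simp_all add: l_def bounded_interval_emeasure[OF Q])
  also have "\<dots> = ennreal (l + 2 * real (card N))"
    by (simp add: l_def ennreal_plus ennreal_mult' ennreal_of_nat_eq_real_of_nat mult.commute)
  also have "\<dots> \<le> ennreal (25 * l)"
    using cardN long by (intro ennreal_leI) (auto simp: l_def)
  finally show ?thesis by (simp add: l_def)
qed

text \<open>The Muckenhoupt \<open>A\<^sub>1\<close> condition: on an interval much shorter than its distance to the poles
  the weight is nearly constant, and otherwise it behaves like \<open>\<bar>x - a\<bar>\<close> to the power
  \<open>-1/2\<close> for the nearest pole \<open>a\<close>, unless the interval is long.\<close>

lemma nn_integral_bump_le:
  assumes Q: "bounded_interval Q" and x: "x \<in> Q" "x \<notin> poles K"
  shows "(\<integral>\<^sup>+y. ennreal (bump K y) * indicator Q y \<partial>lebesgue)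
         \<le> ennreal (25 * measure lebesgue Q * bump K x)"
proof -
  define l where "l = measure lebesgue Q"
  have l: "l > 0" unfolding l_def by (rule bounded_interval_measure_pos[OF Q])
  have dist: "\<bar>y - x\<bar> \<le> l" if "y \<in> Q" for y
    unfolding l_def by (rule bounded_interval_dist_le[OF Q that x(1)])
  have [measurable]: "Q \<in> sets lebesgue" using bounded_interval_lmeasurable[OF Q] by auto
  have const: "(\<integral>\<^sup>+y. ennreal c * indicator Q y \<partial>lebesgue) = ennreal (c * l)" if "c \<ge> 0" for c
    using that
    by (simp add: nn_integral_cmult_indicator bounded_interval_emeasure[OF Q] l_def ennreal_mult)
  obtain a where a: "a \<in> poles K" "infdist x (poles K) = \<bar>x - a\<bar>"
    by (rule nearest_pole)
  have xa: "\<bar>x - a\<bar> > 0" using a x by auto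
  consider (long) "l \<ge> 1/4" | (far) "\<bar>x - a\<bar> \<ge> 2 * l" | (near) "l < 1/4" "\<bar>x - a\<bar> < 2 * l"
    by linarith
  then show ?thesis
  proof cases
    case long
    have "25 * l \<le> 25 * l * bump K x" using l bump_ge_1[of K x] by simp
    then show ?thesis
      using nn_integral_bump_le_long[OF Q, of K] long l_def by (metis ennreal_leI order_trans)
  next
    case far
    \<comment> \<open>Moving by at most l \<le> |x - a| / 2 at most halves the distance to the
      poles, which costs a factor sqrt 2 \<le> 2.\<close>
    have "bump K y \<le> 2 * bump K x" if y: "y \<in> Q" for y
    proof -
      have "infdist y (poles K) \<ge> \<bar>x - a\<bar> - l"
        using infdist_triangle[of x "poles K" y] dist[OF y] a by (simp add: dist_real_def)
      then have "(2 * infdist y (poles K)) powr (- (1/2)) \<le> ((1/2) * (2 * \<bar>x - a\<bar>)) powr (- (1/2))"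
        using far xa by (intro powr_mono2') auto
      also have "\<dots> = (1/2) powr (- (1/2)) * (2 * \<bar>x - a\<bar>) powr (- (1/2))"
        by (rule powr_mult)
      also have "(1/2::real) powr (- (1/2)) \<le> (1/2) powr (- 1)"
        by (intro powr_mono') auto
      also have "(1/2::real) powr (- 1) = 2" by (simp add: powr_minus)
      finally show ?thesis unfolding bump_def a(2) by (auto simp: mult_right_mono)
    qed
    then have "(\<integral>\<^sup>+y. ennreal (bump K y) * indicator Q y \<partial>lebesgue)
        \<le> (\<integral>\<^sup>+y. ennreal (2 * bump K x) * indicator Q y \<partial>lebesgue)"
      by (intro nn_integral_mono) (auto simp: indicator_def intro!: ennreal_leI)
    also have "\<dots> = ennreal (2 * bump K x * l)"
      using bump_pos[of K x] by (intro const) auto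
    also have "\<dots> \<le> ennreal (25 * l * bump K x)"
      using bump_pos[of K x] l by (intro ennreal_leI) auto
    finally show ?thesis by (simp add: l_def)
  next
    case near
    let ?h = "\<lambda>y. (2 * \<bar>y - a\<bar>) powr (- (1/2))"
    have "ennreal (bump K y) * indicator Q y
        \<le> ennreal 2 * indicator Q y + ennreal (?h y) * indicator {a - 3 * l..a + 3 * l} y" for y
    proof (cases "y \<in> Q")
      case True
      have ya: "\<bar>y - a\<bar> \<le> 3 * l" using dist[OF True] near by linarith
      obtain b where b: "b \<in> poles K" "infdist y (poles K) = \<bar>y - b\<bar>"
        by (rule nearest_pole)
      \<comment> \<open>If the pole nearest to \<open>y\<close> is not \<open>a\<close>, it is at
        distance at least 1 - 3l \<ge> 1/4, and its power is at most 2. So \<open>a\<close> is the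
        only singularity that matters on \<open>Q\<close>.\<close>
      have "bump K y \<le> 2 + ?h y"
      proof (cases "b = a")
        case True
        then show ?thesis by (simp add: bump_def b)
      next
        case False
        then have "\<bar>y - b\<bar> \<ge> 1/4" using poles_separated[OF a(1) b(1)] ya near by linarith
        then have "(2 * \<bar>y - b\<bar>) powr (- (1/2)) \<le> (1/2) powr (- (1/2))"
          by (intro powr_mono2') auto
        also have "\<dots> \<le> (1/2) powr (- 1)" by (intro powr_mono') auto
        also have "\<dots> = 2" by (simp add: powr_minus)
        finally show ?thesis by (simp add: bump_def b add_increasing2)
      qed
      then have "ennreal (bump K y) \<le> ennreal 2 + ennreal (?h y)"
        by (metis ennreal_leI ennreal_plus powr_ge_zero zero_le_numeral)
      moreover have "y \<in> {a - 3 * l..a + 3 * l}" using ya by auto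
      ultimately show ?thesis using True by simp
    qed simp
    then have "(\<integral>\<^sup>+y. ennreal (bump K y) * indicator Q y \<partial>lebesgue)
        \<le> (\<integral>\<^sup>+y. ennreal 2 * indicator Q y + ennreal (?h y) * indicator {a - 3 * l..a + 3 * l} y \<partial>lebesgue)"
      by (intro nn_integral_mono)
    also have "\<dots> = ennreal (2 * l) + ennreal (2 * sqrt (2 * (3 * l)))"
    proof (subst nn_integral_add)
      show "(\<integral>\<^sup>+y. ennreal 2 * indicator Q y \<partial>lebesgue)
          + (\<integral>\<^sup>+y. ennreal (?h y) * indicator {a - 3 * l..a + 3 * l} y \<partial>lebesgue)
          = ennreal (2 * l) + ennreal (2 * sqrt (2 * (3 * l)))"
        using l by (subst const nn_integral_inverse_sqrt, simp)+ simp
    qed (auto intro: borel_measurable_inverse_sqrt)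
    also have "\<dots> = ennreal (2 * l + 2 * sqrt (6 * l))"
      using l by (subst ennreal_plus[symmetric]) auto
    also have "\<dots> \<le> ennreal (25 * l * bump K x)"
    proof (rule ennreal_leI)
      \<comment> \<open>Since |x - a| < 2l, \<open>bump K x\<close> is at least of order 1 / sqrt l.
        This lets l times \<open>bump K x\<close> absorb the term sqrt l that comes from integrating
        the singularity.\<close>
      have "(4 * l) powr (- (1/2)) \<le> (2 * \<bar>x - a\<bar>) powr (- (1/2))"
        using xa near by (intro powr_mono2') auto
      also have "\<dots> \<le> bump K x" by (rule bump_ge_pole[OF a(1) x(2)])
      finally have "1 / (2 * sqrt l) \<le> bump K x"
        using l by (simp add: powr_minus powr_half_sqrt real_sqrt_mult field_simps)
      then have "l * (1 / (2 * sqrt l)) \<le> l * bump K x" using l by (intro mult_left_mono) auto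
      moreover have "l * (1 / (2 * sqrt l)) = sqrt l / 2"
        using l by (simp add: field_simps)
      ultimately have 1: "sqrt l \<le> 2 * (l * bump K x)" by simp
      have "sqrt (6 * l) \<le> sqrt (9 * l)" using l by (intro real_sqrt_le_mono) auto
      also have "\<dots> = 3 * sqrt l" by (simp add: real_sqrt_mult)
      finally have 2: "sqrt (6 * l) \<le> 3 * sqrt l" .
      have "l \<le> l * bump K x" using l bump_ge_1[of K x] by simp
      then show "2 * l + 2 * sqrt (6 * l) \<le> 25 * l * bump K x"
        unfolding mult.assoc using 1 2 l bump_pos[of K x] mult_pos_pos[of l "bump K x"] by linarith
    qed
    finally show ?thesis by (simp add: l_def)
  qed
qed

subsection \<open>Diagonal operators on \<open>\<ell>\<^sup>u\<close> and their adjoints\<close>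

lemma ell_vecs_iff: "x \<in> vecs (ell u) \<longleftrightarrow> (\<lambda>k. norm (x k) powr u) summable_on UNIV"
  by (simp add: ell_def)

lemma nrm_ell: "nrm (ell u) x = (\<Sum>\<^sub>\<infinity>k. norm (x k) powr u) powr (1 / u)"
  by (simp add: ell_def)

lemma nrm_ell_nonneg: "nrm (ell u) x \<ge> 0"
  by (simp add: nrm_ell)

lemma nrm_ell_powr:
  assumes "u > 0"
  shows "nrm (ell u) x powr u = (\<Sum>\<^sub>\<infinity>k. norm (x k) powr u)"
  using assms by (simp add: nrm_ell powr_powr infsum_nonneg)

lemma zero_in_ell: "(\<lambda>_. 0) \<in> vecs (ell u)"
  by (simp add: ell_vecs_iff)

lemma nrm_ell_zero: "nrm (ell u) (\<lambda>_. 0) = 0"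
  by (simp add: nrm_ell)

lemma ell_finite_support: "finite {k. x k \<noteq> 0} \<Longrightarrow> x \<in> vecs (ell u)"
  unfolding ell_vecs_iff by (rule finite_nonzero_values_imp_summable_on) simp

lemma ell_add:
  assumes "u > 0" "x \<in> vecs (ell u)" "y \<in> vecs (ell u)"
  shows "(\<lambda>k. x k + y k) \<in> vecs (ell u)"
proof -
  have "norm (x k + y k) powr u \<le> 2 powr u * (norm (x k) powr u + norm (y k) powr u)" for k
  proof -
    have "norm (x k + y k) \<le> 2 * max (norm (x k)) (norm (y k))"
      using norm_triangle_ineq[of "x k" "y k"] by linarith
    then have "norm (x k + y k) powr u \<le> 2 powr u * max (norm (x k)) (norm (y k)) powr u"
      using assms(1) by (metis less_eq_real_def norm_ge_zero powr_mono2 powr_mult)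
    also have "max (norm (x k)) (norm (y k)) powr u \<le> norm (x k) powr u + norm (y k) powr u"
      by (auto simp: max_def)
    finally show ?thesis by simp
  qed
  moreover have "(\<lambda>k. 2 powr u * (norm (x k) powr u + norm (y k) powr u)) summable_on UNIV"
    using assms by (intro summable_on_cmult_right summable_on_add) (auto simp: ell_vecs_iff)
  ultimately show ?thesis
    unfolding ell_vecs_iff by (intro summable_on_comparison_test[where g = "\<lambda>k. norm (x k + y k) powr u"]) auto
qed

definition diag :: "(int \<Rightarrow> real) \<Rightarrow> (int \<Rightarrow> 'k::real_normed_field) \<Rightarrow> (int \<Rightarrow> 'k)" where
  "diag c e = (\<lambda>k. of_real (c k) * e k)"

lemma diag_diag: "diag c (diag d e) = diag (\<lambda>k. c k * d k) e"
  by (simp add: diag_def mult.assoc)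

lemma diag_one: "diag (\<lambda>_. 1) e = e"
  by (simp add: diag_def)

lemma diag_inverse:
  assumes "\<And>k. c k \<noteq> 0"
  shows "diag (\<lambda>k. 1 / c k) (diag c e) = e" "diag c (diag (\<lambda>k. 1 / c k) e) = e"
  using assms by (simp_all add: diag_diag diag_one)

lemma norm_diag_powr: "norm (diag c e k) powr u = \<bar>c k\<bar> powr u * norm (e k) powr u"
  by (simp add: diag_def norm_mult powr_mult)

lemma ell_scale_le:
  assumes "u > 0" "x \<in> vecs (ell u)" "\<And>k. norm (y k) \<le> B * norm (x k)" "B \<ge> 0"
  shows "y \<in> vecs (ell u)" "nrm (ell u) y \<le> B * nrm (ell u) x"
proof -
  have le: "norm (y k) powr u \<le> B powr u * norm (x k) powr u" for k
    using assms by (metis less_eq_real_def norm_ge_zero powr_mono2 powr_mult)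
  have s: "(\<lambda>k. B powr u * norm (x k) powr u) summable_on UNIV"
    using assms by (intro summable_on_cmult_right) (auto simp: ell_vecs_iff)
  show y: "y \<in> vecs (ell u)"
    unfolding ell_vecs_iff by (rule summable_on_comparison_test[OF s]) (use le in auto)
  have "(\<Sum>\<^sub>\<infinity>k. norm (y k) powr u) \<le> (\<Sum>\<^sub>\<infinity>k. B powr u * norm (x k) powr u)"
    using y s le by (intro infsum_mono) (auto simp: ell_vecs_iff)
  also have "\<dots> = B powr u * (\<Sum>\<^sub>\<infinity>k. norm (x k) powr u)"
    by (simp add: infsum_cmult_right')
  finally have "nrm (ell u) y \<le> (B powr u * (\<Sum>\<^sub>\<infinity>k. norm (x k) powr u)) powr (1 / u)"
    unfolding nrm_ell using assms by (intro powr_mono2) (auto intro: infsum_nonneg)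
  also have "\<dots> = B * nrm (ell u) x"
    unfolding nrm_ell using assms by (subst powr_mult) (auto simp: powr_powr intro: infsum_nonneg)
  finally show "nrm (ell u) y \<le> B * nrm (ell u) x" .
qed

lemma ell_mult:
  fixes x :: "int \<Rightarrow> 'k::real_normed_field"
  assumes "u > 0" "x \<in> vecs (ell u)"
  shows "(\<lambda>k. a * x k) \<in> vecs (ell u)" "nrm (ell u) (\<lambda>k. a * x k) \<le> norm a * nrm (ell u) x"
  by (rule ell_scale_le[OF assms, of _ "norm a"]; simp add: norm_mult)+

lemma diag_ell:
  assumes "u > 0" "e \<in> vecs (ell u)" "\<And>k. \<bar>c k\<bar> \<le> B"
  shows "diag c e \<in> vecs (ell u)" "nrm (ell u) (diag c e) \<le> B * nrm (ell u) e"
proof -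
  have "B \<ge> 0" using assms(3)[of 0] by linarith
  moreover have "norm (diag c e k) \<le> B * norm (e k)" for k
    using assms(3)[of k] by (simp add: diag_def norm_mult mult_right_mono)
  ultimately show "diag c e \<in> vecs (ell u)" "nrm (ell u) (diag c e) \<le> B * nrm (ell u) e"
    using ell_scale_le[OF assms(1,2), of "diag c e" B] by auto
qed

lemma bounded_op_diag:
  assumes "u > 0" "\<And>k. \<bar>c k\<bar> \<le> B"
  shows "bounded_op (ell u) (diag c :: (int \<Rightarrow> 'k::real_normed_field) \<Rightarrow> _)"
  unfolding bounded_op_def
proof (intro conjI allI ballI exI[of _ B])
  fix x :: "int \<Rightarrow> 'k" assume "x \<in> vecs (ell u)"
  then show "diag c x \<in> vecs (ell u)" "nrm (ell u) (diag c x) \<le> B * nrm (ell u) x"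
    using diag_ell assms by blast+
qed (simp_all add: diag_def algebra_simps)

lemma invertible_opI:
  assumes "bounded_op X A" "bounded_op X B"
    and "\<And>x. x \<in> vecs X \<Longrightarrow> B (A x) = x" "\<And>x. x \<in> vecs X \<Longrightarrow> A (B x) = x"
  shows "invertible_op X A"
  using assms unfolding invertible_op_def by blast

lemma inv_op_eq:
  assumes "bounded_op X A" "bounded_op X B"
    and "\<And>x. x \<in> vecs X \<Longrightarrow> B (A x) = x" "\<And>x. x \<in> vecs X \<Longrightarrow> A (B x) = x"
    and "x \<in> vecs X"
  shows "inv_op X A x = B x"
proof -
  have "inj_on A (vecs X)" by (rule inj_on_inverseI[of _ B]) (rule assms(3))
  moreover have "B x \<in> vecs X" using assms(2,5) by (auto simp: bounded_op_def)
  ultimately have "inv_into (vecs X) A x = B x"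
    using assms(4)[OF assms(5)] by (intro inv_into_f_eq) auto
  then show ?thesis using invertible_opI[OF assms(1-4)] by (simp add: inv_op_def)
qed

section \<open>The dual of l^u and adjoints of diagonal operators\<close>

lemma dual_vecs_iff:
  "\<phi> \<in> vecs (dual X) \<longleftrightarrow> bounded_functional X \<phi> \<and> (\<forall>x. x \<notin> vecs X \<longrightarrow> \<phi> x = 0)"
  by (simp add: dual_def)

lemma nrm_dual: "nrm (dual X) \<phi> = (SUP x\<in>{x\<in>vecs X. nrm X x \<le> 1}. norm (\<phi> x))"
  by (simp add: dual_def)

lemma nrm_dual_least:
  fixes \<phi> :: "(int \<Rightarrow> 'k::real_normed_field) \<Rightarrow> 'k"
  assumes "\<And>x. x \<in> vecs (ell u) \<Longrightarrow> nrm (ell u) x \<le> 1 \<Longrightarrow> norm (\<phi> x) \<le> M"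
  shows "nrm (dual (ell u)) \<phi> \<le> M"
  unfolding nrm_dual
proof (rule cSUP_least)
  have "(\<lambda>_. 0) \<in> {x \<in> vecs (ell u). nrm (ell u) x \<le> 1}"
    by (simp add: zero_in_ell nrm_ell_zero)
  then show "{x \<in> vecs (ell u). nrm (ell u) x \<le> 1} \<noteq> ({} :: (int \<Rightarrow> 'k) set)" by blast
qed (use assms in auto)

lemma nrm_dual_upper:
  fixes \<phi> :: "(int \<Rightarrow> 'k::real_normed_field) \<Rightarrow> 'k"
  assumes "\<phi> \<in> vecs (dual (ell u))" "x \<in> vecs (ell u)" "nrm (ell u) x \<le> 1"
  shows "norm (\<phi> x) \<le> nrm (dual (ell u)) \<phi>"
  unfolding nrm_dual
proof (rule cSUP_upper)
  obtain K where K: "\<And>x. x \<in> vecs (ell u) \<Longrightarrow> norm (\<phi> x) \<le> K * nrm (ell u) x"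
    using assms(1) unfolding dual_vecs_iff bounded_functional_def by blast
  have "norm (\<phi> y) \<le> \<bar>K\<bar>" if "y \<in> vecs (ell u)" "nrm (ell u) y \<le> 1" for y
  proof -
    have "norm (\<phi> y) \<le> \<bar>K\<bar> * nrm (ell u) y"
      using K[OF that(1)] nrm_ell_nonneg[of u y] by (smt (verit) mult_right_mono)
    also have "\<dots> \<le> \<bar>K\<bar> * 1" using that by (intro mult_left_mono) auto
    finally show ?thesis by simp
  qed
  then show "bdd_above ((\<lambda>x. norm (\<phi> x)) ` {x \<in> vecs (ell u). nrm (ell u) x \<le> 1})"
    by (intro bdd_aboveI2[of _ _ "\<bar>K\<bar>"]) auto
qed (use assms in auto)

lemma nrm_dual_nonneg:
  fixes \<phi> :: "(int \<Rightarrow> 'k::real_normed_field) \<Rightarrow> 'k"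
  assumes "\<phi> \<in> vecs (dual (ell u))"
  shows "nrm (dual (ell u)) \<phi> \<ge> 0"
  using nrm_dual_upper[OF assms zero_in_ell] norm_ge_zero
  by (metis nrm_ell_zero order_trans zero_le_one)

text \<open>A vector of nonzero norm is scaled to norm 1. For a vector of norm 0 the bound contained
  in \<open>bounded_functional\<close> already gives the value 0.\<close>

lemma norm_functional_le:
  fixes \<phi> :: "(int \<Rightarrow> 'k::real_normed_field) \<Rightarrow> 'k"
  assumes "u > 0" "\<phi> \<in> vecs (dual (ell u))" "x \<in> vecs (ell u)"
  shows "norm (\<phi> x) \<le> nrm (dual (ell u)) \<phi> * nrm (ell u) x"
proof (cases "nrm (ell u) x = 0")
  case True
  then show ?thesis using assms(2,3) by (force simp: dual_vecs_iff bounded_functional_def)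
next
  case False
  define a where "a = nrm (ell u) x"
  have a: "a > 0" using False nrm_ell_nonneg[of u x] by (simp add: a_def)
  let ?y = "\<lambda>k. of_real (1 / a) * x k"
  have y: "?y \<in> vecs (ell u)" "nrm (ell u) ?y \<le> norm (of_real (1 / a) :: 'k) * nrm (ell u) x"
    using ell_mult[OF assms(1,3)] by blast+
  have "norm (of_real (1 / a) :: 'k) * nrm (ell u) x = 1"
    unfolding norm_of_real using a by (simp add: a_def)
  then have "norm (\<phi> ?y) \<le> nrm (dual (ell u)) \<phi>"
    using y by (intro nrm_dual_upper assms) auto
  moreover have "\<phi> ?y = of_real (1 / a) * \<phi> x"
    using assms unfolding dual_vecs_iff bounded_functional_def by blast
  then have "norm (\<phi> ?y) = norm (\<phi> x) / a"
    using a by (simp only: norm_mult norm_of_real) simp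
  ultimately show ?thesis using a by (simp add: a_def field_simps)
qed

lemma zero_in_dual: "(\<lambda>_. 0) \<in> vecs (dual (ell u))"
  by (auto simp: dual_vecs_iff bounded_functional_def intro!: exI[of _ 0])

lemma nrm_dual_zero: "nrm (dual (ell u)) (\<lambda>_. 0 :: 'k::real_normed_field) = 0"
  by (rule order_antisym[OF nrm_dual_least nrm_dual_nonneg[OF zero_in_dual]]) simp

lemma adj_diag_dual:
  fixes \<phi> :: "(int \<Rightarrow> 'k::real_normed_field) \<Rightarrow> 'k"
  assumes "u > 0" "\<phi> \<in> vecs (dual (ell u))" "\<And>k. \<bar>c k\<bar> \<le> B"
  shows "adj (ell u) (diag c) \<phi> \<in> vecs (dual (ell u))"
    and "nrm (dual (ell u)) (adj (ell u) (diag c) \<phi>) \<le> B * nrm (dual (ell u)) \<phi>"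
proof -
  have B: "B \<ge> 0" using assms(3)[of 0] by linarith
  have le: "norm (\<phi> (diag c x)) \<le> B * nrm (dual (ell u)) \<phi> * nrm (ell u) x"
    if "x \<in> vecs (ell u)" for x
  proof -
    have "norm (\<phi> (diag c x)) \<le> nrm (dual (ell u)) \<phi> * nrm (ell u) (diag c x)"
      using assms that diag_ell by (intro norm_functional_le) blast+
    also have "\<dots> \<le> nrm (dual (ell u)) \<phi> * (B * nrm (ell u) x)"
      using assms that diag_ell nrm_dual_nonneg by (intro mult_left_mono) blast+
    finally show ?thesis by (simp add: ac_simps)
  qed
  have add: "diag c (\<lambda>i. x i + y i) = (\<lambda>i. diag c x i + diag c y i)"
    and mult: "diag c (\<lambda>i. a * x i) = (\<lambda>i. a * diag c x i)" for a and x y :: "int \<Rightarrow> 'k"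
    by (simp_all add: diag_def algebra_simps)
  have \<phi>: "bounded_functional (ell u) \<phi>" using assms(2) by (simp add: dual_vecs_iff)
  have d: "diag c x \<in> vecs (ell u)" if "x \<in> vecs (ell u)" for x :: "int \<Rightarrow> 'k"
    using diag_ell[OF assms(1) that] assms(3) by blast
  show "adj (ell u) (diag c) \<phi> \<in> vecs (dual (ell u))"
    unfolding dual_vecs_iff bounded_functional_def
  proof (intro conjI allI ballI impI exI[of _ "B * nrm (dual (ell u)) \<phi>"])
    fix x y :: "int \<Rightarrow> 'k" and a :: 'k
    assume x: "x \<in> vecs (ell u)"
    show "norm (adj (ell u) (diag c) \<phi> x) \<le> B * nrm (dual (ell u)) \<phi> * nrm (ell u) x"
      using le[OF x] x by (simp add: adj_def)
    show "adj (ell u) (diag c) \<phi> (\<lambda>i. a * x i) = a * adj (ell u) (diag c) \<phi> x"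
      using \<phi> d[OF x] x ell_mult(1)[OF assms(1) x]
      by (simp add: adj_def mult bounded_functional_def)
    assume y: "y \<in> vecs (ell u)"
    show "adj (ell u) (diag c) \<phi> (\<lambda>i. x i + y i)
        = adj (ell u) (diag c) \<phi> x + adj (ell u) (diag c) \<phi> y"
      using \<phi> d[OF x] d[OF y] x y ell_add[OF assms(1) x y]
      by (simp add: adj_def add bounded_functional_def)
  qed (simp add: adj_def)
  show "nrm (dual (ell u)) (adj (ell u) (diag c) \<phi>) \<le> B * nrm (dual (ell u)) \<phi>"
  proof (rule nrm_dual_least)
    fix x :: "int \<Rightarrow> 'k" assume x: "x \<in> vecs (ell u)" "nrm (ell u) x \<le> 1"
    have "B * nrm (dual (ell u)) \<phi> * nrm (ell u) x \<le> B * nrm (dual (ell u)) \<phi> * 1"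
      using x B nrm_dual_nonneg[OF assms(2)] by (intro mult_left_mono) auto
    then show "norm (adj (ell u) (diag c) \<phi> x) \<le> B * nrm (dual (ell u)) \<phi>"
      using le[OF x(1)] x by (simp add: adj_def)
  qed
qed

lemma bounded_op_adj_diag:
  assumes "u > 0" "\<And>k. \<bar>c k\<bar> \<le> B"
  shows "bounded_op (dual (ell u)) (adj (ell u) (diag c :: (int \<Rightarrow> 'k::real_normed_field) \<Rightarrow> _))"
  unfolding bounded_op_def
proof (intro conjI allI ballI exI[of _ B])
  fix \<phi> :: "(int \<Rightarrow> 'k) \<Rightarrow> 'k" assume "\<phi> \<in> vecs (dual (ell u))"
  then show "adj (ell u) (diag c) \<phi> \<in> vecs (dual (ell u))"
    "nrm (dual (ell u)) (adj (ell u) (diag c) \<phi>) \<le> B * nrm (dual (ell u)) \<phi>"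
    using adj_diag_dual assms by blast+
qed (auto simp: adj_def)

lemma adj_diag_inverse:
  fixes \<phi> :: "(int \<Rightarrow> 'k::real_normed_field) \<Rightarrow> 'k"
  assumes "u > 0" "\<phi> \<in> vecs (dual (ell u))" "\<And>k. c k \<noteq> 0" "\<And>k. \<bar>c k\<bar> \<le> B"
  shows "adj (ell u) (diag c) (adj (ell u) (diag (\<lambda>k. 1 / c k)) \<phi>) = \<phi>"
proof
  fix x :: "int \<Rightarrow> 'k"
  show "adj (ell u) (diag c) (adj (ell u) (diag (\<lambda>k. 1 / c k)) \<phi>) x = \<phi> x"
    using assms diag_ell[OF assms(1), of x c B] by (simp add: adj_def diag_inverse dual_vecs_iff)
qed

text \<open>The bounds keep the images of \<open>x\<close> in the carrier, where \<phi> is additive.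
  Off the carrier all three adjoints vanish.\<close>

lemma adj_diag_diff:
  fixes \<phi> :: "(int \<Rightarrow> 'k::real_normed_field) \<Rightarrow> 'k"
  assumes "u > 0" "\<phi> \<in> vecs (dual (ell u))" "\<And>k. \<bar>c k\<bar> \<le> B" "\<And>k. \<bar>d k\<bar> \<le> B'"
  shows "adj (ell u) (diag c) \<phi> x - adj (ell u) (diag d) \<phi> x = adj (ell u) (diag (\<lambda>k. c k - d k)) \<phi> x"
proof (cases "x \<in> vecs (ell u)")
  case True
  have "\<bar>c k - d k\<bar> \<le> B + B'" for k using assms(3,4)[of k] by linarith
  then have "diag (\<lambda>k. c k - d k) x \<in> vecs (ell u)"
    by (rule diag_ell(1)[OF assms(1) True])
  moreover have "diag d x \<in> vecs (ell u)"
    by (rule diag_ell(1)[OF assms(1) True assms(4)])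
  ultimately have "\<phi> (\<lambda>k. diag (\<lambda>k. c k - d k) x k + diag d x k) = \<phi> (diag (\<lambda>k. c k - d k) x) + \<phi> (diag d x)"
    using assms(2) by (auto simp: dual_vecs_iff bounded_functional_def)
  moreover have "(\<lambda>k. diag (\<lambda>k. c k - d k) x k + diag d x k) = diag c x"
    by (simp add: diag_def algebra_simps)
  ultimately show ?thesis using True by (simp add: adj_def)
qed (simp add: adj_def)

section \<open>Strong measurability of diagonal fields\<close>

lemma strongly_measurable_restrict:
  assumes "strongly_measurable X f" "Q \<in> sets lebesgue" "(\<lambda>_. 0) \<in> vecs X" "nrm X (\<lambda>_. 0) = 0"
  shows "strongly_measurable X (\<lambda>x. if x \<in> Q then f x else (\<lambda>_. 0))"
proof -
  obtain F where F: "\<And>n::nat. simple_function lebesgue (F n)" "\<And>n. range (F n) \<subseteq> vecs X"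
      "\<And>x. (\<lambda>n. nrm X (\<lambda>i. F n x i - f x i)) \<longlonglongrightarrow> 0"
    using assms(1) unfolding strongly_measurable_def by blast
  have "simple_function lebesgue (\<lambda>x. if x \<in> Q then F n x else (\<lambda>_. 0))" for n
    using F(1) assms(2) by (intro simple_function_If_set) auto
  moreover have "(\<lambda>n. nrm X (\<lambda>i. (if x \<in> Q then F n x else (\<lambda>_. 0)) i
      - (if x \<in> Q then f x else (\<lambda>_. 0)) i)) \<longlonglongrightarrow> 0" for x
    using F(3)[of x] assms(4) by simp
  moreover have "range f \<subseteq> vecs X" using assms(1) by (simp add: strongly_measurable_def)
  ultimately show ?thesis
    unfolding strongly_measurable_def using F(2) assms(3)
    by (intro conjI exI[of _ "\<lambda>n x. if x \<in> Q then F n x else (\<lambda>_. 0)"])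
       (auto simp: image_subset_iff)
qed

text \<open>Finiteness is asked over whole balls and not only at each point: then the truncated and
  discretised fields take finitely many sequences as values, which makes them simple.\<close>

definition locally_finite_field :: "(real \<Rightarrow> int \<Rightarrow> real) \<Rightarrow> bool" where
  "locally_finite_field c \<longleftrightarrow>
     (\<forall>k. (\<lambda>x. c x k) \<in> borel_measurable lebesgue) \<and>
     (\<forall>n::nat. finite {k. \<exists>x. \<bar>x\<bar> \<le> real n \<and> c x k \<noteq> 1})"

lemma locally_finite_field_bounded:
  assumes "locally_finite_field c"
  obtains B where "\<And>k. \<bar>c x k\<bar> \<le> B"
proof -
  obtain n :: nat where "\<bar>x\<bar> \<le> real n" using real_arch_simple by blast
  then have "{k. c x k \<noteq> 1} \<subseteq> {k. \<exists>x. \<bar>x\<bar> \<le> real n \<and> c x k \<noteq> 1}" by auto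
  then have fin: "finite {k. c x k \<noteq> 1}"
    using assms by (intro finite_subset[OF \<open>_ \<subseteq> _\<close>]) (simp add: locally_finite_field_def)
  have "\<bar>c x k\<bar> \<le> 1 + (\<Sum>k\<in>{k. c x k \<noteq> 1}. \<bar>c x k\<bar>)" for k
  proof (cases "c x k = 1")
    case False
    then show ?thesis using member_le_sum[OF _ _ fin, of k "\<lambda>k. \<bar>c x k\<bar>"] by force
  qed (simp add: sum_nonneg)
  then show ?thesis using that by blast
qed

text \<open>Convergence is uniform in \<open>k\<close>, so the diagonal operators converge in
  operator norm at each \<open>x\<close>. Hence the same approximation serves l^u and its dual, with
  no appeal to separability.\<close>

lemma simple_approximation:
  assumes c: "locally_finite_field c"
  obtains C :: "nat \<Rightarrow> real \<Rightarrow> int \<Rightarrow> real"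
  where "\<And>n. simple_function lebesgue (C n)"
    and "\<And>x. \<forall>\<^sub>F n in sequentially. \<forall>k. \<bar>C n x k - c x k\<bar> \<le> 1 / real n"
    and "\<And>n x. \<exists>B. \<forall>k. \<bar>C n x k\<bar> \<le> B"
proof -
  \<comment> \<open>Rounding down to multiples of 1/n, cut off outside [-n, n] to leave finitely
    many values. For \<open>n = 0\<close> division by zero gives the value 0.\<close>
  define q :: "nat \<Rightarrow> real \<Rightarrow> real" where
    "q n y = (if \<bar>y\<bar> \<le> real n then real_of_int \<lfloor>real n * y\<rfloor> / real n else 0)" for n y
  define A where "A n = {k. \<exists>x. \<bar>x\<bar> \<le> real n \<and> c x k \<noteq> 1}" for n :: nat
  define C where "C n x k = (if \<bar>x\<bar> \<le> real n \<and> k \<in> A n then q n (c x k) else 1)" for n x k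
  have finA: "finite (A n)" for n using c by (simp add: A_def locally_finite_field_def)
  have [measurable]: "(\<lambda>x. c x k) \<in> borel_measurable lebesgue" for k
    using c by (simp add: locally_finite_field_def)
  have [measurable]: "(\<lambda>x. x) \<in> borel_measurable lebesgue"
    by (rule measurable_completion) measurable
  have q_range: "q n y \<in> (\<lambda>i. real_of_int i / real n) ` {- int (n * n)..int (n * n)}" for n y
  proof (cases "\<bar>y\<bar> \<le> real n")
    case True
    then have "\<bar>real n * y\<bar> \<le> real n * real n" by (simp add: abs_mult mult_left_mono)
    then have "\<lfloor>real n * y\<rfloor> \<in> {- int (n * n)..int (n * n)}"
      by (auto simp: abs_le_iff le_floor_iff floor_le_iff)
    then show ?thesis using True by (auto simp: q_def)
  next
    case False
    then show ?thesis by (auto simp: q_def intro!: image_eqI[of _ _ 0])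
  qed
  have q_simple: "simple_function lebesgue (\<lambda>x. if \<bar>x\<bar> \<le> real n then q n (c x k) else 1)" for n k
  proof (rule simple_function_borel_measurable)
    show "(\<lambda>x. if \<bar>x\<bar> \<le> real n then q n (c x k) else 1) \<in> borel_measurable lebesgue"
      unfolding q_def by measurable
    have "(\<lambda>x. if \<bar>x\<bar> \<le> real n then q n (c x k) else 1) ` space lebesgue
        \<subseteq> insert 1 ((\<lambda>i. real_of_int i / real n) ` {- int (n * n)..int (n * n)})"
      using q_range by auto
    then show "finite ((\<lambda>x. if \<bar>x\<bar> \<le> real n then q n (c x k) else 1) ` space lebesgue)"
      by (rule finite_subset) simp
  qed
  \<comment> \<open>A function with values in sequences is simple if it is built from finitely many
    simple coordinates, adjoined one at a time by function update.\<close>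
  have "simple_function lebesgue (\<lambda>x k. if \<bar>x\<bar> \<le> real n \<and> k \<in> S then q n (c x k) else 1)"
    if "finite S" for n S
    using that
  proof induction
    case (insert k S)
    have "simple_function lebesgue (\<lambda>x. (\<lambda>f v. f(k := v))
        (\<lambda>k. if \<bar>x\<bar> \<le> real n \<and> k \<in> S then q n (c x k) else 1)
        (if \<bar>x\<bar> \<le> real n then q n (c x k) else 1))"
      by (rule simple_function_compose2[OF insert.IH q_simple])
    then show ?case
      by (rule back_subst[of "simple_function lebesgue"]) (auto simp: fun_eq_iff)
  qed simp
  then have "simple_function lebesgue (C n)" for n
    using finA unfolding C_def[abs_def] by blast
  moreover have "\<forall>\<^sub>F n in sequentially. \<forall>k. \<bar>C n x k - c x k\<bar> \<le> 1 / real n" for x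
  proof -
    obtain B where B: "\<And>k. \<bar>c x k\<bar> \<le> B" using locally_finite_field_bounded[OF c] by blast
    \<comment> \<open>From \<open>N\<close> on neither cutoff is active: the point lies in the ball
      and all entries lie in [-n, n]. Coordinates outside \<open>A n\<close> are then reproduced
      exactly.\<close>
    obtain N :: nat where N: "max 1 (max \<bar>x\<bar> B) \<le> real N" using real_arch_simple by blast
    have "\<bar>C n x k - c x k\<bar> \<le> 1 / real n" if "n \<ge> N" for n k
    proof -
      have n: "1 \<le> real n" "\<bar>x\<bar> \<le> real n" "B \<le> real n" using N that by auto
      show ?thesis
      proof (cases "k \<in> A n")
        case True
        let ?r = "real_of_int \<lfloor>real n * c x k\<rfloor> - real n * c x k"
        have "real_of_int \<lfloor>real n * c x k\<rfloor> / real n - c x k = ?r / real n"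
          using n(1) by (simp add: diff_divide_distrib)
        moreover have "\<bar>?r\<bar> / real n \<le> 1 / real n"
          by (intro divide_right_mono) linarith+
        ultimately have "\<bar>real_of_int \<lfloor>real n * c x k\<rfloor> / real n - c x k\<bar> \<le> 1 / real n"
          by (simp only: abs_divide abs_of_nat)
        then show ?thesis using True n B[of k] by (simp add: C_def q_def)
      next
        case False
        then have "c x k = 1" using n by (auto simp: A_def)
        then show ?thesis using False by (simp add: C_def)
      qed
    qed
    then show ?thesis by (auto simp: eventually_sequentially)
  qed
  moreover have "\<exists>B. \<forall>k. \<bar>C n x k\<bar> \<le> B" for n x
  proof -
    have "\<bar>q n y\<bar> \<le> real n * real n + 1" for y
    proof -
      obtain i where i: "q n y = real_of_int i / real n" "i \<in> {- int (n * n)..int (n * n)}"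
        using q_range[of n y] by blast
      have "\<bar>q n y\<bar> \<le> \<bar>real_of_int i\<bar>"
        unfolding i(1) by (cases "n = 0") (auto simp: abs_divide divide_le_eq mult_le_cancel_left1)
      also have "\<dots> \<le> real n * real n" 
      proof -
        have "\<bar>i\<bar> \<le> int (n * n)" using i(2) by (simp only: atLeastAtMost_iff) linarith
        then show ?thesis by (metis of_int_abs of_int_le_iff of_int_of_nat_eq of_nat_mult)
      qed
      finally show ?thesis by simp
    qed
    then show ?thesis by (intro exI[of _ "real n * real n + 1"]) (auto simp: C_def)
  qed
  ultimately show ?thesis by (rule that)
qed

lemma strongly_measurable_diag:
  fixes e :: "int \<Rightarrow> 'k::real_normed_field"
  assumes u: "u > 0" and c: "locally_finite_field c" and e: "e \<in> vecs (ell u)"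
  shows "strongly_measurable (ell u) (\<lambda>x. diag (c x) e)"
proof -
  obtain C :: "nat \<Rightarrow> real \<Rightarrow> int \<Rightarrow> real" where C: "\<And>n. simple_function lebesgue (C n)"
      "\<And>x. \<forall>\<^sub>F n in sequentially. \<forall>k. \<bar>C n x k - c x k\<bar> \<le> 1 / real n"
      "\<And>n x. \<exists>B. \<forall>k. \<bar>C n x k\<bar> \<le> B"
    using simple_approximation[OF c] by blast
  show ?thesis
    unfolding strongly_measurable_def
  proof (intro conjI exI[of _ "\<lambda>n x. diag (C n x) e"] allI)
    show "range (\<lambda>x. diag (c x) e) \<subseteq> vecs (ell u)"
      using diag_ell(1)[OF u e] locally_finite_field_bounded[OF c] by (metis image_subsetI)
    show "simple_function lebesgue (\<lambda>x. diag (C n x) e)" for n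
      by (rule simple_function_compose1[OF C(1), of "\<lambda>c. diag c e"])
    show "range (\<lambda>x. diag (C n x) e) \<subseteq> vecs (ell u)" for n
      using diag_ell(1)[OF u e] C(3) by (metis image_subsetI)
    fix x
    have "\<forall>\<^sub>F n in sequentially. nrm (ell u) (\<lambda>i. diag (C n x) e i - diag (c x) e i) \<le> nrm (ell u) e / real n"
      using C(2)[of x]
    proof eventually_elim
      case (elim n)
      then have "nrm (ell u) (diag (\<lambda>k. C n x k - c x k) e) \<le> 1 / real n * nrm (ell u) e"
        by (intro diag_ell[OF u e]) blast
      then show ?case by (simp add: diag_def algebra_simps)
    qed
    with always_eventually
    show "(\<lambda>n. nrm (ell u) (\<lambda>i. diag (C n x) e i - diag (c x) e i)) \<longlonglongrightarrow> 0"
      by (rule tendsto_sandwich[OF _ _ tendsto_const lim_const_over_n]) (simp add: nrm_ell_nonneg)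
  qed
qed

lemma strongly_measurable_adj_diag:
  fixes \<phi> :: "(int \<Rightarrow> 'k::real_normed_field) \<Rightarrow> 'k"
  assumes u: "u > 0" and c: "locally_finite_field c" and \<phi>: "\<phi> \<in> vecs (dual (ell u))"
  shows "strongly_measurable (dual (ell u)) (\<lambda>x. adj (ell u) (diag (c x)) \<phi>)"
proof -
  obtain C :: "nat \<Rightarrow> real \<Rightarrow> int \<Rightarrow> real" where C: "\<And>n. simple_function lebesgue (C n)"
      "\<And>x. \<forall>\<^sub>F n in sequentially. \<forall>k. \<bar>C n x k - c x k\<bar> \<le> 1 / real n"
      "\<And>n x. \<exists>B. \<forall>k. \<bar>C n x k\<bar> \<le> B"
    using simple_approximation[OF c] by blast
  show ?thesis
    unfolding strongly_measurable_def
  proof (intro conjI exI[of _ "\<lambda>n x. adj (ell u) (diag (C n x)) \<phi>"] allI)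
    show "range (\<lambda>x. adj (ell u) (diag (c x)) \<phi>) \<subseteq> vecs (dual (ell u))"
      using adj_diag_dual(1)[OF u \<phi>] locally_finite_field_bounded[OF c] by (metis image_subsetI)
    show "simple_function lebesgue (\<lambda>x. adj (ell u) (diag (C n x)) \<phi>)" for n
      by (rule simple_function_compose1[OF C(1), of "\<lambda>c. adj (ell u) (diag c) \<phi>"])
    show "range (\<lambda>x. adj (ell u) (diag (C n x)) \<phi>) \<subseteq> vecs (dual (ell u))" for n
      using adj_diag_dual(1)[OF u \<phi>] C(3) by (metis image_subsetI)
    fix x
    let ?d = "\<lambda>n i. adj (ell u) (diag (C n x)) \<phi> i - adj (ell u) (diag (c x)) \<phi> i"
    obtain B where B: "\<And>k. \<bar>c x k\<bar> \<le> B" using locally_finite_field_bounded[OF c] by blast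
    have diff: "?d n = adj (ell u) (diag (\<lambda>k. C n x k - c x k)) \<phi>" for n
      using adj_diag_diff[OF u \<phi>] C(3)[of n x] B by blast
    \<comment> \<open>Membership in the dual is recorded with the bound, because
      \<open>nrm_dual_nonneg\<close> needs it for the lower half of the sandwich.\<close>
    have ev: "\<forall>\<^sub>F n in sequentially. ?d n \<in> vecs (dual (ell u))
        \<and> nrm (dual (ell u)) (?d n) \<le> nrm (dual (ell u)) \<phi> / real n"
      using C(2)[of x]
    proof eventually_elim
      case (elim n)
      have "adj (ell u) (diag (\<lambda>k. C n x k - c x k)) \<phi> \<in> vecs (dual (ell u))"
        by (rule adj_diag_dual(1)[OF u \<phi>]) (use elim in blast)
      moreover have "nrm (dual (ell u)) (adj (ell u) (diag (\<lambda>k. C n x k - c x k)) \<phi>)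
          \<le> 1 / real n * nrm (dual (ell u)) \<phi>"
        by (rule adj_diag_dual(2)[OF u \<phi>]) (use elim in blast)
      ultimately show ?case unfolding diff by simp
    qed
    show "(\<lambda>n. nrm (dual (ell u)) (?d n)) \<longlonglongrightarrow> 0"
    proof (rule tendsto_sandwich[OF _ _ tendsto_const lim_const_over_n])
      show "\<forall>\<^sub>F n in sequentially. 0 \<le> nrm (dual (ell u)) (?d n)"
        using ev by eventually_elim (auto intro: nrm_dual_nonneg)
      show "\<forall>\<^sub>F n in sequentially. nrm (dual (ell u)) (?d n) \<le> nrm (dual (ell u)) \<phi> / real n"
        using ev by eventually_elim blast
    qed
  qed
qed

subsection \<open>The diagonal weight\<close>

text \<open>The right-hand side minus q - 1 lies above the tangent to t^q at t = 1. The inequality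
  is Young's inequality for t^q and 1 with weights 1/q and 1 - 1/q.\<close>

lemma bernoulli_powr:
  fixes t q :: real
  assumes "t \<ge> 0" "q \<ge> 1"
  shows "q * t \<le> t powr q + (q - 1)"
proof (cases "t = 0")
  case False
  then have "(t powr q) powr (1 / q) * 1 powr (1 - 1 / q) \<le> 1 / q * t powr q + (1 - 1 / q) * 1"
    using assms by (intro Youngs_inequality_0) auto
  then have "t \<le> t powr q / q + (1 - 1 / q)"
    using assms False by (simp add: powr_powr)
  then have "q * t \<le> q * (t powr q / q + (1 - 1 / q))"
    using assms by (intro mult_left_mono) auto
  also have "\<dots> = t powr q + (q - 1)"
    using assms by (simp add: distrib_left right_diff_distrib)
  finally show ?thesis .
qed (use assms in auto)

text \<open>With Y the mean of z, \<open>bernoulli_powr\<close> at z_k / Y is multiplied by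
  \<theta>_k Y^q and summed. The lower bounds add up to q Y^q - (q - 1) Y^q = Y^q.\<close>

lemma jensen_powr_infsum:
  fixes \<theta> z :: "'a \<Rightarrow> real"
  assumes q: "q \<ge> 1" and nonneg: "\<And>k. \<theta> k \<ge> 0" "\<And>k. z k \<ge> 0"
    and \<theta>: "(\<theta> has_sum 1) UNIV"
    and z: "(\<lambda>k. \<theta> k * z k) summable_on UNIV" "(\<lambda>k. \<theta> k * z k powr q) summable_on UNIV"
  shows "(\<Sum>\<^sub>\<infinity>k. \<theta> k * z k) powr q \<le> (\<Sum>\<^sub>\<infinity>k. \<theta> k * z k powr q)"
proof (cases "(\<Sum>\<^sub>\<infinity>k. \<theta> k * z k) = 0")
  case False
  define Y where "Y = (\<Sum>\<^sub>\<infinity>k. \<theta> k * z k)"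
  have Y: "Y > 0" using False nonneg by (simp add: Y_def infsum_nonneg less_le)
  have "((\<lambda>k. Y powr q * (q / Y) * (\<theta> k * z k) + - (Y powr q * (q - 1)) * \<theta> k) has_sum
      (Y powr q * (q / Y) * Y + - (Y powr q * (q - 1)) * 1)) UNIV"
    unfolding Y_def by (intro has_sum_add has_sum_cmult_right \<theta> has_sum_infsum z)
  moreover have "Y powr q * (q / Y) * (\<theta> k * z k) + - (Y powr q * (q - 1)) * \<theta> k \<le> \<theta> k * z k powr q" for k
  proof -
    have "q * (z k / Y) \<le> (z k / Y) powr q + (q - 1)"
      using Y nonneg q by (intro bernoulli_powr) auto
    then have "(Y powr q * \<theta> k) * (q * (z k / Y)) \<le> (Y powr q * \<theta> k) * ((z k / Y) powr q + (q - 1))"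
      using nonneg by (intro mult_left_mono) auto
    also have "\<dots> = \<theta> k * z k powr q + Y powr q * (q - 1) * \<theta> k"
      using Y by (simp add: powr_divide algebra_simps)
    finally show ?thesis by (simp add: mult_ac)
  qed
  ultimately have "Y powr q * (q / Y) * Y + - (Y powr q * (q - 1)) * 1 \<le> (\<Sum>\<^sub>\<infinity>k. \<theta> k * z k powr q)"
    using z(2) by (intro has_sum_mono[OF _ has_sum_infsum]) auto
  moreover have "Y powr q * (q / Y) * Y + - (Y powr q * (q - 1)) * 1 = Y powr q"
    using Y by (simp add: algebra_simps)
  ultimately show ?thesis by (simp add: Y_def)
qed (use nonneg in \<open>auto intro: infsum_nonneg\<close>)

text \<open>Turns sums over coordinates into integrals over counting measure, so that Tonelli's
  theorem can exchange them with integrals over the line.\<close>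

lemma nn_integral_count_space_infsum:
  fixes f :: "'a \<Rightarrow> real"
  assumes "f summable_on UNIV" "\<And>k. f k \<ge> 0"
  shows "(\<integral>\<^sup>+k. ennreal (f k) \<partial>count_space UNIV) = ennreal (\<Sum>\<^sub>\<infinity>k. f k)"
proof -
  have "Infinite_Set_Sum.abs_summable_on f UNIV"
    using assms by (simp add: abs_summable_equivalent[symmetric])
  then show ?thesis
    using assms by (simp add: nn_integral_conv_infsetsum infsetsum_infsum)
qed

lemma epowr_ennreal: "x \<ge> 0 \<Longrightarrow> epowr (ennreal x) a = ennreal (x powr a)"
  by (simp add: epowr_def)

lemma epowr_mono:
  assumes "a \<ge> 0" "y \<le> z"
  shows "epowr y a \<le> epowr z a"
  using assms by (cases y; cases z) (auto simp: epowr_def top_unique intro: powr_mono2)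

definition wt :: "real \<Rightarrow> real \<Rightarrow> int \<Rightarrow> real" where
  "wt m x k = bump (nat \<bar>k\<bar>) x powr (1 / m)"

lemma wt_ge_1: "m > 0 \<Longrightarrow> wt m x k \<ge> 1"
  by (simp add: wt_def ge_one_powr_ge_zero bump_ge_1)

lemma wt_pos: "m > 0 \<Longrightarrow> wt m x k > 0"
  using wt_ge_1[of m x k] by linarith

lemma wt_powr: "m > 0 \<Longrightarrow> wt m x k powr m = bump (nat \<bar>k\<bar>) x"
  using bump_pos[of "nat \<bar>k\<bar>" x] by (simp add: wt_def powr_powr)

lemma borel_measurable_bump_lebesgue [measurable]: "bump K \<in> borel_measurable lebesgue"
  by (rule measurable_completion) measurable

text \<open>For |k| > n + 1 the interval [-n, n] lies to the left of |k| - 1/2, where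
  \<open>bump_eq_1\<close> applies.\<close>

lemma locally_finite_wt: "locally_finite_field (wt m)"
proof -
  have "{k. \<exists>x. \<bar>x\<bar> \<le> real n \<and> wt m x k \<noteq> 1} \<subseteq> {- int (n + 1)..int (n + 1)}" for n
  proof safe
    fix k x assume x: "\<bar>x\<bar> \<le> real n" "wt m x k \<noteq> 1"
    show "k \<in> {- int (n + 1)..int (n + 1)}"
    proof (rule ccontr)
      assume "k \<notin> {- int (n + 1)..int (n + 1)}"
      then have "nat \<bar>k\<bar> > n + 1" by auto
      then have "bump (nat \<bar>k\<bar>) x = 1" using x(1) by (intro bump_eq_1) linarith
      then show False using x(2) by (simp add: wt_def)
    qed
  qed
  then have "finite {k. \<exists>x. \<bar>x\<bar> \<le> real n \<and> wt m x k \<noteq> 1}" for n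
    by (rule finite_subset) simp
  moreover have "(\<lambda>x. wt m x k) \<in> borel_measurable lebesgue" for k
    unfolding wt_def by measurable
  ultimately show ?thesis by (simp add: locally_finite_field_def)
qed

lemma locally_finite_field_inverse:
  assumes "locally_finite_field c"
  shows "locally_finite_field (\<lambda>x k. 1 / c x k)"
proof -
  have "1 / c x k \<noteq> 1 \<longleftrightarrow> c x k \<noteq> 1" for x k by (auto simp: divide_eq_eq)
  then show ?thesis using assms unfolding locally_finite_field_def
    by (auto intro!: borel_measurable_divide)
qed

text \<open>Jensen's inequality for the probability weights \<open>\<bar>a k\<bar>\<^sup>u \<bar>e k\<bar>\<^sup>u / \<parallel>a e\<parallel>\<^sup>u\<close>
  takes the place of Minkowski's inequality for \<open>L\<^sup>m(\<ell>\<^sup>u)\<close> and reduces the bound to the scalar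
  weights.\<close>

lemma nn_integral_nrm_diag_wt_le:
  fixes e :: "int \<Rightarrow> 'k::real_normed_field"
  assumes u: "u \<ge> 1" "m \<ge> u" and b: "0 < b" "b \<le> m" and Q: "bounded_interval Q"
    and e: "e \<in> vecs (ell u)" and a: "\<And>k. a k \<ge> 1" "\<And>k. a k \<le> B"
    and bound: "\<And>k. e k \<noteq> 0 \<Longrightarrow> (\<integral>\<^sup>+y. ennreal (bump (nat \<bar>k\<bar>) y) * indicator Q y \<partial>lebesgue)
                  \<le> ennreal (25 * measure lebesgue Q * a k powr m)"
  shows "(\<integral>\<^sup>+y. ennreal (nrm (ell u) (diag (wt m y) e) powr b) * indicator Q y \<partial>lebesgue)
         \<le> ennreal (26 * measure lebesgue Q * nrm (ell u) (diag a e) powr b)"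
proof (cases "nrm (ell u) (diag a e) = 0")
  case True
  have absa: "\<bar>a k\<bar> \<le> B" "\<bar>a k\<bar> = a k" for k using a[of k] by auto
  have ae: "diag a e \<in> vecs (ell u)" using u by (intro diag_ell(1)[OF _ e, of _ B] absa) auto
  have "(\<Sum>\<^sub>\<infinity>k. norm (diag a e k) powr u) = 0"
    using True u nrm_ell_powr[of u "diag a e"] by simp
  then have "norm (diag a e k) powr u = 0" for k
    using ae by (intro nonneg_infsum_le_0D[where A = UNIV]) (auto simp: ell_vecs_iff)
  then have "e k = 0" for k using a(1)[of k] by (force simp: diag_def)
  then have "diag (wt m y) e = (\<lambda>_. 0)" for y by (simp add: diag_def)
  then show ?thesis by (simp add: nrm_ell_zero)
next
  case False
  have u0: "u > 0" and m0: "m > 0" using u by auto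
  have [measurable]: "Q \<in> sets lebesgue" using bounded_interval_lmeasurable[OF Q] by auto
  define l where "l = measure lebesgue Q"
  have l: "l > 0" unfolding l_def by (rule bounded_interval_measure_pos[OF Q])
  have absa: "\<bar>a k\<bar> \<le> B" "\<bar>a k\<bar> = a k" "a k > 0" for k using a[of k] by auto
  have ae: "diag a e \<in> vecs (ell u)" using diag_ell(1)[OF u0 e] absa by blast
  define A where "A = nrm (ell u) (diag a e)"
  have A: "A > 0" using False nrm_ell_nonneg[of u "diag a e"] by (simp add: A_def)
  define \<theta> where "\<theta> k = a k powr u * norm (e k) powr u / A powr u" for k
  define N where "N y = nrm (ell u) (diag (wt m y) e)" for y
  have N0: "N y \<ge> 0" for y by (simp add: N_def nrm_ell_nonneg)
  have \<theta>0: "\<theta> k \<ge> 0" for k by (simp add: \<theta>_def)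
  have norm_ae: "norm (diag a e k) powr u = a k powr u * norm (e k) powr u" for k
    by (simp add: norm_diag_powr absa(2))
  have Apow: "A powr u = (\<Sum>\<^sub>\<infinity>k. a k powr u * norm (e k) powr u)"
    using nrm_ell_powr[OF u0, of "diag a e"] by (simp add: A_def norm_ae)
  have "((\<lambda>k. a k powr u * norm (e k) powr u / A powr u) has_sum (A powr u / A powr u)) UNIV"
    unfolding divide_inverse
    using ae by (intro has_sum_cmult_left) (auto simp: ell_vecs_iff norm_ae Apow)
  then have \<theta>: "(\<theta> has_sum 1) UNIV"
    using A by (simp add: \<theta>_def[abs_def])
  have pointwise: "ennreal (N y powr b)
      \<le> ennreal (A powr b) * (1 + (\<integral>\<^sup>+k. ennreal (\<theta> k / a k powr m) * ennreal (bump (nat \<bar>k\<bar>) y) \<partial>count_space UNIV))" for y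
  proof -
    obtain B' where B': "\<And>k. \<bar>wt m y k\<bar> \<le> B'"
      using locally_finite_field_bounded[OF locally_finite_wt] by blast
    have wt: "wt m y k > 0" for k by (rule wt_pos[OF m0])
    \<comment> \<open>The \<theta>-mean of z is (N y / A)^u, and z_k to the power m/u is
      \<open>bump\<close> divided by a_k^m. Jensen's inequality with exponent m/u \<ge> 1 thus
      bounds (N y / A)^m linearly in the scalar weights.\<close>
    define z where "z k = (wt m y k / a k) powr u" for k
    have z: "\<theta> k * z k = norm (diag (wt m y) e k) powr u / A powr u" for k
      using wt[of k] absa(3)[of k] by (simp add: \<theta>_def z_def norm_diag_powr powr_divide)
    have zq: "z k powr (m / u) = bump (nat \<bar>k\<bar>) y / a k powr m" for k
      using u0 wt[of k] absa(3)[of k] by (simp add: z_def powr_powr powr_divide wt_powr[OF m0])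
    have we: "diag (wt m y) e \<in> vecs (ell u)" using diag_ell(1)[OF u0 e B'] .
    have sum_z: "(\<lambda>k. \<theta> k * z k) summable_on UNIV"
      unfolding z divide_inverse using we by (intro summable_on_cmult_left) (simp add: ell_vecs_iff)
    \<comment> \<open>This bound depends on \<open>y\<close> and serves only to secure summability
      before Jensen's inequality is applied.\<close>
    have ratio_le: "bump (nat \<bar>k\<bar>) y / a k powr m \<le> B' powr m" for k
    proof -
      have "bump (nat \<bar>k\<bar>) y \<le> B' powr m"
        unfolding wt_powr[OF m0, symmetric] using B'[of k] wt[of k] m0 by (intro powr_mono2) auto
      moreover have "1 \<le> a k powr m" using a(1)[of k] m0 by (simp add: ge_one_powr_ge_zero)
      moreover have "0 < bump (nat \<bar>k\<bar>) y" by (rule bump_pos)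
      ultimately have "bump (nat \<bar>k\<bar>) y / a k powr m \<le> B' powr m / 1"
        by (intro frac_le) auto
      then show ?thesis by simp
    qed
    have "(\<lambda>k. \<theta> k * B' powr m) summable_on UNIV"
      using \<theta> by (intro summable_on_cmult_left has_sum_imp_summable)
    then have sum_zq: "(\<lambda>k. \<theta> k * z k powr (m / u)) summable_on UNIV"
    proof (rule summable_on_comparison_test)
      show "\<theta> k * z k powr (m / u) \<le> \<theta> k * B' powr m" for k
        unfolding zq by (rule mult_left_mono[OF ratio_le \<theta>0])
      show "0 \<le> \<theta> k * z k powr (m / u)" for k
        by (rule mult_nonneg_nonneg[OF \<theta>0]) simp
    qed
    have "(\<Sum>\<^sub>\<infinity>k. \<theta> k * z k) = N y powr u / A powr u"
      unfolding z divide_inverse N_def nrm_ell_powr[OF u0] by (rule infsum_cmult_left')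
    then have "(N y / A) powr m = (\<Sum>\<^sub>\<infinity>k. \<theta> k * z k) powr (m / u)"
      using A u0 N0[of y] by (simp add: powr_divide[symmetric] powr_powr)
    also have "\<dots> \<le> (\<Sum>\<^sub>\<infinity>k. \<theta> k * z k powr (m / u))"
      using u u0 \<theta>0 by (intro jensen_powr_infsum \<theta> sum_z sum_zq) (auto simp: z_def)
    finally have jensen: "(N y / A) powr m \<le> (\<Sum>\<^sub>\<infinity>k. \<theta> k * z k powr (m / u))" .
    have "(\<integral>\<^sup>+k. ennreal (\<theta> k / a k powr m) * ennreal (bump (nat \<bar>k\<bar>) y) \<partial>count_space UNIV)
        = (\<integral>\<^sup>+k. ennreal (\<theta> k * z k powr (m / u)) \<partial>count_space UNIV)"
      by (intro nn_integral_cong) (simp add: zq ennreal_mult''[symmetric] bump_pos less_imp_le)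
    also have "\<dots> = ennreal (\<Sum>\<^sub>\<infinity>k. \<theta> k * z k powr (m / u))"
      using \<theta>0 by (intro nn_integral_count_space_infsum sum_zq) auto
    finally have sum_eq: "(\<integral>\<^sup>+k. ennreal (\<theta> k / a k powr m) * ennreal (bump (nat \<bar>k\<bar>) y) \<partial>count_space UNIV)
        = ennreal (\<Sum>\<^sub>\<infinity>k. \<theta> k * z k powr (m / u))" .
    \<comment> \<open>Passes from the exponent m to b \<le> m. The extra 1 raises the scalar
      constant 25 to 26.\<close>
    have "(N y / A) powr b \<le> 1 + (N y / A) powr m"
    proof (cases "N y / A \<le> 1")
      case True
      then have "(N y / A) powr b \<le> 1"
        using A b N0[of y] by (intro powr_le1) auto
      then show ?thesis by (simp add: add_increasing2)
    next
      case False
      then have "(N y / A) powr b \<le> (N y / A) powr m" using b by (intro powr_mono) auto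
      then show ?thesis by simp
    qed
    also have "\<dots> \<le> 1 + (\<Sum>\<^sub>\<infinity>k. \<theta> k * z k powr (m / u))" using jensen by simp
    finally have "A powr b * (N y / A) powr b \<le> A powr b * (1 + (\<Sum>\<^sub>\<infinity>k. \<theta> k * z k powr (m / u)))"
      by (intro mult_left_mono) auto
    moreover have "A powr b * (N y / A) powr b = N y powr b"
      using A N0[of y] by (simp add: powr_divide)
    moreover have "(\<Sum>\<^sub>\<infinity>k. \<theta> k * z k powr (m / u)) \<ge> 0" using \<theta>0 by (auto intro: infsum_nonneg)
    ultimately show ?thesis
      unfolding sum_eq by (simp add: ennreal_mult'[symmetric] ennreal_leI flip: ennreal_1 ennreal_plus)
  qed
  have \<theta>_int: "(\<integral>\<^sup>+k. ennreal (\<theta> k) \<partial>count_space UNIV) = 1"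
    using \<theta> \<theta>0 by (subst nn_integral_count_space_infsum) (auto simp: has_sum_imp_summable infsumI)
  \<comment> \<open>The summand 1 of the pointwise bound is distributed over the coordinates as the
    sum of the \<theta>_k, so that the whole bound is a single sum over \<open>k\<close>.\<close>
  let ?g = "\<lambda>k y. ennreal (\<theta> k) * indicator Q y
    + ennreal (\<theta> k / a k powr m) * (ennreal (bump (nat \<bar>k\<bar>) y) * indicator Q y)"
  have "(\<integral>\<^sup>+y. ennreal (N y powr b) * indicator Q y \<partial>lebesgue)
      \<le> (\<integral>\<^sup>+y. (\<integral>\<^sup>+k. ennreal (A powr b) * ?g k y \<partial>count_space UNIV) \<partial>lebesgue)"
  proof (rule nn_integral_mono)
    fix y
    show "ennreal (N y powr b) * indicator Q y \<le> (\<integral>\<^sup>+k. ennreal (A powr b) * ?g k y \<partial>count_space UNIV)"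
      using pointwise[of y] by (cases "y \<in> Q") (auto simp: nn_integral_cmult nn_integral_add \<theta>_int)
  qed
  also have "\<dots> = (\<integral>\<^sup>+k. (\<integral>\<^sup>+y. ennreal (A powr b) * ?g k y \<partial>lebesgue) \<partial>count_space UNIV)"
    by (rule nn_integral_count_space_nn_integral) auto
  also have "\<dots> \<le> (\<integral>\<^sup>+k. ennreal (26 * l * A powr b) * ennreal (\<theta> k) \<partial>count_space UNIV)"
  proof (rule nn_integral_mono)
    fix k
    have \<theta>_bump: "ennreal (\<theta> k / a k powr m)
        * (\<integral>\<^sup>+y. ennreal (bump (nat \<bar>k\<bar>) y) * indicator Q y \<partial>lebesgue) \<le> ennreal (25 * l * \<theta> k)"
    \<comment> \<open>The scalar bound is assumed on the support of \<open>e\<close> only; elsewhere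
      \<theta>_k vanishes.\<close>
    proof (cases "e k = 0")
      case False
      have "ennreal (\<theta> k / a k powr m) * (\<integral>\<^sup>+y. ennreal (bump (nat \<bar>k\<bar>) y) * indicator Q y \<partial>lebesgue)
          \<le> ennreal (\<theta> k / a k powr m) * ennreal (25 * l * a k powr m)"
        unfolding l_def by (intro mult_left_mono bound False) auto
      also have "\<dots> = ennreal (25 * l * \<theta> k)"
        using absa(3)[of k] \<theta>0[of k] by (simp add: ennreal_mult'[symmetric] mult.commute)
      finally show ?thesis .
    qed (use u0 in \<open>simp add: \<theta>_def\<close>)
    have "(\<integral>\<^sup>+y. ennreal (A powr b) * ?g k y \<partial>lebesgue)
        = ennreal (A powr b) * (ennreal (\<theta> k) * emeasure lebesgue Q + ennreal (\<theta> k / a k powr m)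
            * (\<integral>\<^sup>+y. ennreal (bump (nat \<bar>k\<bar>) y) * indicator Q y \<partial>lebesgue))"
      by (simp add: nn_integral_cmult nn_integral_add)
    also have "\<dots> \<le> ennreal (A powr b) * (ennreal (\<theta> k) * emeasure lebesgue Q + ennreal (25 * l * \<theta> k))"
      by (intro mult_left_mono add_left_mono \<theta>_bump) auto
    also have "\<dots> = ennreal (26 * l * A powr b) * ennreal (\<theta> k)"
      using l \<theta>0[of k]
      by (simp add: bounded_interval_emeasure[OF Q] l_def[symmetric] ennreal_mult'[symmetric]
          mult_ac flip: ennreal_plus)
    finally show "(\<integral>\<^sup>+y. ennreal (A powr b) * ?g k y \<partial>lebesgue)
        \<le> ennreal (26 * l * A powr b) * ennreal (\<theta> k)" .
  qed
  also have "\<dots> = ennreal (26 * l * A powr b)"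
    by (simp add: nn_integral_cmult \<theta>_int)
  finally show ?thesis by (simp add: l_def A_def N_def)
qed

text \<open>Used in two ways: \<open>a = wt m x\<close> compares the average with the value at a
  point, and \<open>a = 1\<close> gives plain boundedness on long intervals. Since
  \<open>bound\<close> concerns only the support of \<open>e\<close>, zero vectors on short
  intervals are covered too.\<close>

lemma rho_diag_wt_le:
  fixes e :: "int \<Rightarrow> 'k::real_normed_field"
  assumes u: "u \<ge> 1" "m \<ge> u" and b: "1 \<le> b" "b \<le> m" and Q: "bounded_interval Q"
    and e: "e \<in> vecs (ell u)" and a: "\<And>k. a k \<ge> 1" "\<And>k. a k \<le> B"
    and bound: "\<And>k. e k \<noteq> 0 \<Longrightarrow> (\<integral>\<^sup>+y. ennreal (bump (nat \<bar>k\<bar>) y) * indicator Q y \<partial>lebesgue)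
                  \<le> ennreal (25 * measure lebesgue Q * a k powr m)"
  shows "rho (ell u) (\<lambda>x. diag (wt m x)) b Q e \<le> ennreal (26 * nrm (ell u) (diag a e))"
proof -
  let ?A = "nrm (ell u) (diag a e)"
  have l: "measure lebesgue Q > 0" by (rule bounded_interval_measure_pos[OF Q])
  have "(\<integral>\<^sup>+y. ennreal (nrm (ell u) (diag (wt m y) e) powr b) * indicator Q y \<partial>lebesgue) / emeasure lebesgue Q
      \<le> ennreal (26 * measure lebesgue Q * ?A powr b) / ennreal (measure lebesgue Q)"
    unfolding bounded_interval_emeasure[OF Q]
    using b by (intro divide_right_mono_ennreal nn_integral_nrm_diag_wt_le[OF u _ b(2) Q e a bound]) auto
  also have "\<dots> = ennreal (26 * ?A powr b)"
    using l by (simp add: divide_ennreal)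
  finally have "rho (ell u) (\<lambda>x. diag (wt m x)) b Q e \<le> epowr (ennreal (26 * ?A powr b)) (1 / b)"
    unfolding rho_def using b by (intro epowr_mono) auto
  also have "\<dots> = ennreal (26 powr (1 / b) * ?A)"
    using b nrm_ell_nonneg[of u "diag a e"] by (simp add: epowr_ennreal powr_mult powr_powr)
  also have "\<dots> \<le> ennreal (26 * ?A)"
    using powr_mono[of "1 / b" 1 26] b nrm_ell_nonneg[of u "diag a e"]
    by (intro ennreal_leI mult_right_mono) auto
  finally show ?thesis .
qed

section \<open>Pointwise control of averages and the A condition\<close>

definition all_poles :: "real set" where
  "all_poles = (\<Union>K. poles K)"

lemma AE_not_all_poles: "AE x in lebesgue. x \<notin> all_poles"
proof -
  have "countable all_poles" by (simp add: all_poles_def countable_poles)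
  then have "all_poles \<in> null_sets lebesgue"
    using countable_imp_null_set_lborel null_sets_completionI by blast
  then show ?thesis by (rule AE_not_in)
qed

lemma exists_not_pole:
  assumes "bounded_interval Q"
  obtains x where "x \<in> Q" "x \<notin> all_poles"
proof -
  have "\<not> Q \<subseteq> all_poles"
  proof
    assume "Q \<subseteq> all_poles"
    moreover have "countable all_poles" by (simp add: all_poles_def countable_poles)
    ultimately have "countable Q" by (rule countable_subset)
    then have "measure lebesgue Q = 0"
      by (metis countable_imp_null_set_lborel measure_eq_0_null_sets null_sets_completionI)
    then show False using bounded_interval_measure_pos[OF assms] by simp
  qed
  then show ?thesis using that by blast
qed

text \<open>The vector-valued analogue of the A_1 condition: off the common countable exceptional
  set, \<open>a = wt m x\<close> is admissible in every coordinate by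
  \<open>nn_integral_bump_le\<close>.\<close>

lemma rho_diag_wt_le_point:
  fixes e :: "int \<Rightarrow> 'k::real_normed_field"
  assumes u: "u \<ge> 1" "m \<ge> u" and b: "1 \<le> b" "b \<le> m" and Q: "bounded_interval Q"
    and x: "x \<in> Q" "x \<notin> all_poles" and e: "e \<in> vecs (ell u)"
  shows "rho (ell u) (\<lambda>x. diag (wt m x)) b Q e \<le> ennreal (26 * nrm (ell u) (diag (wt m x) e))"
proof -
  have m: "m > 0" using u by simp
  obtain B where B: "\<And>k. \<bar>wt m x k\<bar> \<le> B"
    using locally_finite_field_bounded[OF locally_finite_wt] by blast
  show ?thesis
  proof (rule rho_diag_wt_le[OF u b Q e])
    show "wt m x k \<ge> 1" for k by (rule wt_ge_1[OF m])
    show "wt m x k \<le> B" for k using B[of k] by linarith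
    show "(\<integral>\<^sup>+y. ennreal (bump (nat \<bar>k\<bar>) y) * indicator Q y \<partial>lebesgue)
        \<le> ennreal (25 * measure lebesgue Q * wt m x k powr m)" for k
      unfolding wt_powr[OF m] using x by (intro nn_integral_bump_le[OF Q]) (auto simp: all_poles_def)
  qed
qed

lemma inv_op_diag_wt:
  fixes e :: "int \<Rightarrow> 'k::real_normed_field"
  assumes "u > 0" "m > 0"
  shows "bounded_op (ell u) (diag (wt m x) :: (int \<Rightarrow> 'k) \<Rightarrow> _)"
    and "invertible_op (ell u) (diag (wt m x) :: (int \<Rightarrow> 'k) \<Rightarrow> _)"
    and "e \<in> vecs (ell u) \<Longrightarrow> inv_op (ell u) (diag (wt m x)) e = diag (\<lambda>k. 1 / wt m x k) e"
proof -
  obtain B where B: "\<And>k. \<bar>wt m x k\<bar> \<le> B"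
    using locally_finite_field_bounded[OF locally_finite_wt] by blast
  have B': "\<bar>1 / wt m x k\<bar> \<le> 1" for k using wt_ge_1[OF assms(2), of x k] by simp
  note ops = bounded_op_diag[OF assms(1), of "wt m x" B, OF B]
    bounded_op_diag[OF assms(1), of "\<lambda>k. 1 / wt m x k" 1, OF B']
  have nz: "wt m x k \<noteq> 0" for k using wt_pos[OF assms(2), of x k] by simp
  show "bounded_op (ell u) (diag (wt m x) :: (int \<Rightarrow> 'k) \<Rightarrow> _)" by (rule ops(1))
  show "invertible_op (ell u) (diag (wt m x) :: (int \<Rightarrow> 'k) \<Rightarrow> _)"
    by (rule invertible_opI[OF ops]) (simp_all add: diag_inverse nz)
  show "inv_op (ell u) (diag (wt m x)) e = diag (\<lambda>k. 1 / wt m x k) e" if "e \<in> vecs (ell u)"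
    by (rule inv_op_eq[OF ops _ _ that]) (simp_all add: diag_inverse nz)
qed

lemma inv_adj_diag_wt:
  assumes "u > 0" "m > 0"
  shows "inv_adj (ell u) (\<lambda>x. diag (wt m x)) x \<phi> = adj (ell u) (diag (\<lambda>k. 1 / wt m x k)) \<phi>"
  unfolding inv_adj_def adj_def by (rule ext) (simp add: inv_op_diag_wt(3)[OF assms])

text \<open>The inverse of the adjoint of V(x)^{-1} is the adjoint of V(x). It is bounded for each
  \<open>x\<close> by local finiteness, with a bound that may depend on \<open>x\<close>.\<close>

lemma inv_op_adj_diag_wt:
  fixes \<phi> :: "(int \<Rightarrow> 'k::real_normed_field) \<Rightarrow> 'k"
  assumes "u > 0" "m > 0"
  defines "A \<equiv> inv_adj (ell u) (\<lambda>x. diag (wt m x)) :: (int \<Rightarrow> 'k, 'k) op_field"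
  shows "bounded_op (dual (ell u)) (A x)" and "invertible_op (dual (ell u)) (A x)"
    and "\<phi> \<in> vecs (dual (ell u)) \<Longrightarrow> inv_op (dual (ell u)) (A x) \<phi> = adj (ell u) (diag (wt m x)) \<phi>"
proof -
  obtain B where B: "\<And>k. \<bar>wt m x k\<bar> \<le> B"
    using locally_finite_field_bounded[OF locally_finite_wt] by blast
  have B': "\<bar>1 / wt m x k\<bar> \<le> 1" for k using wt_ge_1[OF assms(2), of x k] by simp
  have A: "A x = adj (ell u) (diag (\<lambda>k. 1 / wt m x k))"
    unfolding A_def using inv_adj_diag_wt[OF assms(1,2)] by blast
  note ops = bounded_op_adj_diag[OF assms(1), of "\<lambda>k. 1 / wt m x k" 1, OF B'] 
    bounded_op_adj_diag[OF assms(1), of "wt m x" B, OF B]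
  have nz: "wt m x k \<noteq> 0" "1 / wt m x k \<noteq> 0" for k using wt_pos[OF assms(2), of x k] by simp_all
  have i1: "adj (ell u) (diag (wt m x)) (adj (ell u) (diag (\<lambda>k. 1 / wt m x k)) \<psi>) = \<psi>"
    and i2: "adj (ell u) (diag (\<lambda>k. 1 / wt m x k)) (adj (ell u) (diag (wt m x)) \<psi>) = \<psi>"
    if "\<psi> \<in> vecs (dual (ell u))" for \<psi> :: "(int \<Rightarrow> 'k) \<Rightarrow> 'k"
    using adj_diag_inverse[OF assms(1) that, of "wt m x" B, OF nz(1) B]
       adj_diag_inverse[OF assms(1) that, of "\<lambda>k. 1 / wt m x k" 1, OF nz(2) B'] by simp_all
  show "bounded_op (dual (ell u)) (A x)" unfolding A by (rule ops(1))
  show "invertible_op (dual (ell u)) (A x)" 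
    unfolding A by (rule invertible_opI[OF ops]) (simp_all add: i1 i2)
  show "inv_op (dual (ell u)) (A x) \<phi> = adj (ell u) (diag (wt m x)) \<phi>"
    if "\<phi> \<in> vecs (dual (ell u))"
    unfolding A by (rule inv_op_eq[OF ops _ _ that]) (simp_all add: i1 i2)
qed

lemma weight_diag_wt:
  assumes "u > 0" "m > 0"
  shows "weight (ell u) (\<lambda>x. diag (wt m x) :: (int \<Rightarrow> 'k::real_normed_field) \<Rightarrow> _)"
  unfolding weight_def
proof (intro conjI allI ballI AE_I2)
  fix e :: "int \<Rightarrow> 'k" assume e: "e \<in> vecs (ell u)"
  show "strongly_measurable (ell u) (\<lambda>x. diag (wt m x) e)"
    by (rule strongly_measurable_diag[OF assms(1) locally_finite_wt e])
  show "strongly_measurable (ell u) (\<lambda>x. inv_op (ell u) (diag (wt m x)) e)"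
    unfolding inv_op_diag_wt(3)[OF assms e]
    by (rule strongly_measurable_diag[OF assms(1) locally_finite_field_inverse[OF locally_finite_wt] e])
qed (use inv_op_diag_wt[OF assms] in auto)

lemma weight_inv_adj_diag_wt:
  assumes "u > 0" "m > 0"
  shows "weight (dual (ell u)) (inv_adj (ell u) (\<lambda>x. diag (wt m x) :: (int \<Rightarrow> 'k::real_normed_field) \<Rightarrow> _))"
  unfolding weight_def
proof (intro conjI allI ballI AE_I2)
  fix \<phi> :: "(int \<Rightarrow> 'k) \<Rightarrow> 'k" assume \<phi>: "\<phi> \<in> vecs (dual (ell u))"
  show "strongly_measurable (dual (ell u)) (\<lambda>x. inv_adj (ell u) (\<lambda>x. diag (wt m x)) x \<phi>)"
    unfolding inv_adj_diag_wt[OF assms]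
    by (rule strongly_measurable_adj_diag[OF assms(1) locally_finite_field_inverse[OF locally_finite_wt] \<phi>])
  show "strongly_measurable (dual (ell u))
      (\<lambda>x. inv_op (dual (ell u)) (inv_adj (ell u) (\<lambda>x. diag (wt m x)) x) \<phi>)"
    unfolding inv_op_adj_diag_wt(3)[OF assms \<phi>]
    by (rule strongly_measurable_adj_diag[OF assms(1) locally_finite_wt \<phi>])
qed (use inv_op_adj_diag_wt[OF assms] in auto)

lemma Lp_qnorm_finite:
  assumes "(\<integral>\<^sup>+x. epowr (f x) w \<partial>lebesgue) < \<infinity>"
  shows "Lp_qnorm w f < \<infinity>"
  using assms by (simp add: Lp_qnorm_def epowr_def)

lemma in_Lp_restrictI:
  assumes f: "strongly_measurable X f" and Q: "Q \<in> sets lebesgue"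
    and zero: "(\<lambda>_. 0) \<in> vecs X" "nrm X (\<lambda>_. 0) = 0" and nonneg: "\<And>x. nrm X (f x) \<ge> 0"
    and fin: "(\<integral>\<^sup>+x. ennreal (nrm X (f x) powr w) * indicator Q x \<partial>lebesgue) < \<infinity>"
  shows "in_Lp X w (\<lambda>x. if x \<in> Q then f x else (\<lambda>_. 0))"
  unfolding in_Lp_def
proof (intro conjI strongly_measurable_restrict f Q zero Lp_qnorm_finite)
  have "(\<integral>\<^sup>+x. epowr (ennreal (nrm X (if x \<in> Q then f x else (\<lambda>_. 0)))) w \<partial>lebesgue)
      = (\<integral>\<^sup>+x. ennreal (nrm X (f x) powr w) * indicator Q x \<partial>lebesgue)"
    using nonneg zero by (intro nn_integral_cong) (auto simp: epowr_def)
  then show "(\<integral>\<^sup>+x. epowr (ennreal (nrm X (if x \<in> Q then f x else (\<lambda>_. 0)))) w \<partial>lebesgue) < \<infinity>"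
    using fin by simp
qed

text \<open>One point of \<open>Q\<close> off the poles suffices: the finite norm of V(x) e there
  bounds the integral over \<open>Q\<close>.\<close>

lemma w_weight_diag_wt:
  assumes u: "u \<ge> 1" "m \<ge> u" and w: "w > 0" "w \<le> m"
  shows "w_weight (ell u) w (\<lambda>x. diag (wt m x) :: (int \<Rightarrow> 'k::real_normed_field) \<Rightarrow> _)"
  unfolding w_weight_def
proof (intro conjI allI impI ballI)
  have um: "u > 0" "m > 0" using u by auto
  show "weight (ell u) (\<lambda>x. diag (wt m x) :: (int \<Rightarrow> 'k::real_normed_field) \<Rightarrow> _)"
    by (rule weight_diag_wt[OF um])
  fix Q and e :: "int \<Rightarrow> 'k" assume Q: "bounded_interval Q" and e: "e \<in> vecs (ell u)"
  obtain x where x: "x \<in> Q" "x \<notin> all_poles" by (rule exists_not_pole[OF Q])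
  obtain B where B: "\<And>k. \<bar>wt m x k\<bar> \<le> B"
    using locally_finite_field_bounded[OF locally_finite_wt] by blast
  have "(\<integral>\<^sup>+y. ennreal (nrm (ell u) (diag (wt m y) e) powr w) * indicator Q y \<partial>lebesgue)
      \<le> ennreal (26 * measure lebesgue Q * nrm (ell u) (diag (wt m x) e) powr w)"
  proof (rule nn_integral_nrm_diag_wt_le[OF u w Q e])
    show "wt m x k \<ge> 1" for k by (rule wt_ge_1[OF um(2)])
    show "wt m x k \<le> B" for k using B[of k] by linarith
    show "(\<integral>\<^sup>+y. ennreal (bump (nat \<bar>k\<bar>) y) * indicator Q y \<partial>lebesgue)
        \<le> ennreal (25 * measure lebesgue Q * wt m x k powr m)" for k
      unfolding wt_powr[OF um(2)] using x by (intro nn_integral_bump_le[OF Q]) (auto simp: all_poles_def)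
  qed
  then have "(\<integral>\<^sup>+y. ennreal (nrm (ell u) (diag (wt m y) e) powr w) * indicator Q y \<partial>lebesgue) < \<infinity>"
    by (rule le_less_trans) simp
  then show "in_Lp (ell u) w (\<lambda>x. if x \<in> Q then diag (wt m x) e else (\<lambda>_. 0))"
    using bounded_interval_lmeasurable[OF Q]
    by (intro in_Lp_restrictI strongly_measurable_diag um e locally_finite_wt zero_in_ell
        nrm_ell_zero nrm_ell_nonneg) auto
qed

text \<open>All entries of V are at least 1, so V^{-1} and its adjoint are contractions, and the
  integrand is dominated by a constant on \<open>Q\<close>.\<close>

lemma w_weight_inv_adj_diag_wt:
  assumes "u > 0" "m > 0" "w > 0"
  shows "w_weight (dual (ell u)) w (inv_adj (ell u) (\<lambda>x. diag (wt m x) :: (int \<Rightarrow> 'k::real_normed_field) \<Rightarrow> _))"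
  unfolding w_weight_def
proof (intro conjI allI impI ballI)
  show "weight (dual (ell u)) (inv_adj (ell u) (\<lambda>x. diag (wt m x) :: (int \<Rightarrow> 'k::real_normed_field) \<Rightarrow> _))"
    by (rule weight_inv_adj_diag_wt[OF assms(1,2)])
  fix Q and \<phi> :: "(int \<Rightarrow> 'k) \<Rightarrow> 'k"
  assume Q: "bounded_interval Q" and \<phi>: "\<phi> \<in> vecs (dual (ell u))"
  let ?f = "\<lambda>x. adj (ell u) (diag (\<lambda>k. 1 / wt m x k)) \<phi>"
  have le1: "\<bar>1 / wt m x k\<bar> \<le> 1" for x k using wt_ge_1[OF assms(2), of x k] by simp
  have nonneg: "nrm (dual (ell u)) (?f x) \<ge> 0" for x
    by (rule nrm_dual_nonneg[OF adj_diag_dual(1)[OF assms(1) \<phi> le1]])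
  have "nrm (dual (ell u)) (?f x) \<le> 1 * nrm (dual (ell u)) \<phi>" for x
    by (rule adj_diag_dual(2)[OF assms(1) \<phi> le1])
  then have "nrm (dual (ell u)) (?f x) powr w \<le> nrm (dual (ell u)) \<phi> powr w" for x
    using nonneg[of x] assms(3) by (intro powr_mono2) auto
  then have "(\<integral>\<^sup>+x. ennreal (nrm (dual (ell u)) (?f x) powr w) * indicator Q x \<partial>lebesgue)
      \<le> (\<integral>\<^sup>+x. ennreal (nrm (dual (ell u)) \<phi> powr w) * indicator Q x \<partial>lebesgue)"
    by (intro nn_integral_mono mult_right_mono ennreal_leI) auto
  also have "\<dots> = ennreal (nrm (dual (ell u)) \<phi> powr w) * emeasure lebesgue Q"
    using bounded_interval_lmeasurable[OF Q] by (intro nn_integral_cmult_indicator) auto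
  also have "\<dots> < \<infinity>"
    by (simp add: bounded_interval_emeasure[OF Q] ennreal_mult_less_top)
  finally show "in_Lp (dual (ell u)) w
      (\<lambda>x. if x \<in> Q then inv_adj (ell u) (\<lambda>x. diag (wt m x)) x \<phi> else (\<lambda>_. 0))"
    unfolding inv_adj_diag_wt[OF assms(1,2)]
    using bounded_interval_lmeasurable[OF Q] nonneg
    by (intro in_Lp_restrictI strongly_measurable_adj_diag assms \<phi> locally_finite_wt
        locally_finite_field_inverse zero_in_dual nrm_dual_zero) auto
qed

text \<open>A test vector \<open>y\<close> for the dual norm at a point \<open>x\<close> is turned into the test vector
  \<open>V(x)\<^sup>-\<^sup>1 y\<close> for the dual of \<open>\<rho>\<close>.\<close>

lemma nrm_inv_adj_le_dual_rho:
  fixes \<phi> :: "(int \<Rightarrow> 'k::real_normed_field) \<Rightarrow> 'k"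
  assumes u: "u \<ge> 1" "m \<ge> u" and w: "1 \<le> w" "w \<le> m" and Q: "bounded_interval Q"
    and x: "x \<in> Q" "x \<notin> all_poles" and d: "d \<ge> 0"
    and D: "dual_rho (ell u) (rho (ell u) (\<lambda>x. diag (wt m x)) w Q) \<phi> = ennreal d"
    and \<phi>: "\<phi> \<in> vecs (dual (ell u))"
  shows "nrm (dual (ell u)) (adj (ell u) (diag (\<lambda>k. 1 / wt m x k)) \<phi>) \<le> 26 * d"
proof (rule nrm_dual_least)
  have um: "u > 0" "m > 0" using u by auto
  fix y :: "int \<Rightarrow> 'k" assume y: "y \<in> vecs (ell u)" "nrm (ell u) y \<le> 1"
  define e where "e = diag (\<lambda>k. 1 / wt m x k) y"
  have le1: "\<bar>1 / wt m x k\<bar> \<le> 1" for x k using wt_ge_1[OF um(2), of x k] by simp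
  have e: "e \<in> vecs (ell u)" unfolding e_def by (rule diag_ell(1)[OF um(1) y(1) le1])
  have "diag (wt m x) e = y"
    unfolding e_def using wt_pos[OF um(2), of x] by (intro diag_inverse) (simp add: less_imp_neq[symmetric])
  then have rho: "rho (ell u) (\<lambda>x. diag (wt m x)) w Q e \<le> ennreal 26"
    using rho_diag_wt_le_point[OF u w Q x e] y(2) ennreal_leI[of "26 * nrm (ell u) y" 26]
    by (auto intro: order_trans)
  show "norm (adj (ell u) (diag (\<lambda>k. 1 / wt m x k)) \<phi> y) \<le> 26 * d"
  proof (cases "\<phi> e = 0")
    case True
    then show ?thesis using y d by (simp add: adj_def e_def)
  next
    case False
    have "\<phi> (\<lambda>i. 0 * e i) = 0 * \<phi> e"
      using \<phi> e unfolding dual_vecs_iff bounded_functional_def by blast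
    then have "e \<noteq> (\<lambda>_. 0)" using False by auto
    then have le: "ennreal (norm (\<phi> e)) / rho (ell u) (\<lambda>x. diag (wt m x)) w Q e \<le> ennreal d"
      unfolding D[symmetric] dual_rho_def using e by (intro SUP_upper) auto
    obtain c where c: "rho (ell u) (\<lambda>x. diag (wt m x)) w Q e = ennreal c" "0 \<le> c" "c \<le> 26"
      using rho by (cases "rho (ell u) (\<lambda>x. diag (wt m x)) w Q e")
        (auto simp: top_unique simp flip: ennreal_numeral)
    \<comment> \<open>A positive number divided by 0 is infinite in \<open>ennreal\<close>, which
      the finite \<open>d\<close> excludes.\<close>
    have "c \<noteq> 0" using le c False by (auto simp: top_unique)
    then have "norm (\<phi> e) / c \<le> d" using le c d by (simp add: divide_ennreal)
    then have "norm (\<phi> e) \<le> d * c" using c \<open>c \<noteq> 0\<close> by (simp add: divide_le_eq)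
    also have "\<dots> \<le> d * 26" using c d by (intro mult_left_mono) auto
    finally show ?thesis using y by (simp add: adj_def e_def)
  qed
qed

text \<open>The bound \<open>nrm_inv_adj_le_dual_rho\<close> holds at almost every point of
  \<open>Q\<close>, and averaging its power w' preserves the constant 26. If the dual of \<rho> is
  infinite, so is the right-hand side.\<close>

lemma A_class_diag_wt:
  assumes u: "u \<ge> 1" "m \<ge> u" and w: "1 < w" "w \<le> m"
  shows "A_class (ell u) w (\<lambda>x. diag (wt m x) :: (int \<Rightarrow> 'k::real_normed_field) \<Rightarrow> _)"
  unfolding A_class_def Let_def
proof (intro conjI exI[of _ 26] allI impI ballI)
  let ?V = "\<lambda>x. diag (wt m x) :: (int \<Rightarrow> 'k) \<Rightarrow> _"
  have um: "u > 0" "m > 0" using u by auto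
  define w' where "w' = w / (w - 1)"
  have w': "w' > 0" using w by (simp add: w'_def)
  show "w_weight (ell u) w ?V" using w by (intro w_weight_diag_wt u) auto
  show "w_weight (dual (ell u)) (w / (w - 1)) (inv_adj (ell u) ?V)"
    using w' by (intro w_weight_inv_adj_diag_wt um) (simp add: w'_def)
  fix Q and \<phi> :: "(int \<Rightarrow> 'k) \<Rightarrow> 'k"
  assume Q: "bounded_interval Q" and \<phi>: "\<phi> \<in> vecs (dual (ell u))"
  show "rho (dual (ell u)) (inv_adj (ell u) ?V) (w / (w - 1)) Q \<phi>
      \<le> ennreal 26 * dual_rho (ell u) (rho (ell u) ?V w Q) \<phi>"
  proof (cases "dual_rho (ell u) (rho (ell u) ?V w Q) \<phi>")
    case top
    then show ?thesis by (simp add: ennreal_mult_top)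
  next
    case (real d)
    have l: "measure lebesgue Q > 0" by (rule bounded_interval_measure_pos[OF Q])
    have le1: "\<bar>1 / wt m x k\<bar> \<le> 1" for x k using wt_ge_1[OF um(2), of x k] by simp
    have "AE x in lebesgue. ennreal (nrm (dual (ell u)) (inv_adj (ell u) ?V x \<phi>) powr w') * indicator Q x
        \<le> ennreal ((26 * d) powr w') * indicator Q x"
      using AE_not_all_poles
    proof eventually_elim
      case (elim x)
      show ?case
      proof (cases "x \<in> Q")
        case True
        have "nrm (dual (ell u)) (adj (ell u) (diag (\<lambda>k. 1 / wt m x k)) \<phi>) \<le> 26 * d"
          using w real by (intro nrm_inv_adj_le_dual_rho[OF u _ w(2) Q True elim _ _ \<phi>]) auto
        then show ?thesis
          using True w' nrm_dual_nonneg[OF adj_diag_dual(1)[OF um(1) \<phi> le1]]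
          by (auto simp: inv_adj_diag_wt[OF um] intro!: ennreal_leI powr_mono2)
      qed simp
    qed
    then have "(\<integral>\<^sup>+x. ennreal (nrm (dual (ell u)) (inv_adj (ell u) ?V x \<phi>) powr w') * indicator Q x \<partial>lebesgue)
        \<le> (\<integral>\<^sup>+x. ennreal ((26 * d) powr w') * indicator Q x \<partial>lebesgue)"
      by (rule nn_integral_mono_AE)
    also have "\<dots> = ennreal ((26 * d) powr w') * emeasure lebesgue Q"
      using bounded_interval_lmeasurable[OF Q] by (intro nn_integral_cmult_indicator) auto
    finally have "(\<integral>\<^sup>+x. ennreal (nrm (dual (ell u)) (inv_adj (ell u) ?V x \<phi>) powr w') * indicator Q x \<partial>lebesgue)
        / emeasure lebesgue Q \<le> ennreal ((26 * d) powr w') * emeasure lebesgue Q / emeasure lebesgue Q"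
      by (rule divide_right_mono_ennreal)
    also have "\<dots> = ennreal ((26 * d) powr w')"
      using l by (simp add: bounded_interval_emeasure[OF Q] divide_ennreal ennreal_mult[symmetric])
    finally have "rho (dual (ell u)) (inv_adj (ell u) ?V) w' Q \<phi> \<le> epowr (ennreal ((26 * d) powr w')) (1 / w')"
      unfolding rho_def using w' by (intro epowr_mono) auto
    also have "\<dots> = ennreal (26 * d)"
      using real w' by (simp add: epowr_ennreal powr_powr)
    also have "\<dots> = ennreal 26 * dual_rho (ell u) (rho (ell u) ?V w Q) \<phi>"
      using real by (simp add: ennreal_mult)
    finally show ?thesis by (simp add: w'_def)
  qed
qed

subsection \<open>Dyadic intervals and the test sequences\<close>

lemma dyadic_eq:
  assumes "Q \<in> dyadic j"
  obtains k :: int where "Q = {2 powr (- real_of_int j) * of_int k..<2 powr (- real_of_int j) * (of_int k + 1)}"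
proof -
  have "(2::real) powi (- j) = 2 powr (- real_of_int j)"
    using powr_real_of_int'[of 2 "- j"] by simp
  then show ?thesis using assms that by (auto simp: dyadic_def)
qed

lemma measure_dyadic: "Q \<in> dyadic j \<Longrightarrow> measure lebesgue Q = 2 powr (- real_of_int j)"
  by (erule dyadic_eq) (simp add: algebra_simps)

lemma bounded_interval_dyadic:
  assumes "Q \<in> dyadic j"
  shows "bounded_interval Q"
proof -
  obtain k :: int where k: "Q = {2 powr (- real_of_int j) * of_int k..<2 powr (- real_of_int j) * (of_int k + 1)}"
    using assms by (rule dyadic_eq)
  have "interior Q \<noteq> {}"
    unfolding k by (simp add: interior_atLeastLessThan algebra_simps)
  moreover have "bounded Q"
    unfolding k by (rule bounded_subset[OF compact_imp_bounded[OF compact_Icc]]) (use atLeastLessThan_subseteq_atLeastAtMost_iff in blast)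
  ultimately show ?thesis by (simp add: bounded_interval_def k is_interval_co)
qed

text \<open>Reading off the index as a floor yields both existence and uniqueness of the dyadic
  interval of a given level around a point.\<close>

lemma dyadic_mem_iff:
  assumes "Q = {2 powr (- real_of_int j) * of_int k..<2 powr (- real_of_int j) * (of_int k + 1)}"
  shows "x \<in> Q \<longleftrightarrow> k = \<lfloor>x * 2 powr real_of_int j\<rfloor>"
proof -
  have "x \<in> Q \<longleftrightarrow> of_int k \<le> x * 2 powr real_of_int j \<and> x * 2 powr real_of_int j < of_int k + 1"
    by (simp add: assms powr_minus field_simps)
  then show ?thesis by (auto simp: floor_unique le_floor_iff floor_less_iff eq_commute[of k])
qed

lemma dyadic_mem_unique:
  assumes "Q \<in> dyadic j" "Q' \<in> dyadic j" "x \<in> Q" "x \<in> Q'"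
  shows "Q = Q'"
proof -
  obtain k k' :: int
    where "Q = {2 powr (- real_of_int j) * of_int k..<2 powr (- real_of_int j) * (of_int k + 1)}"
      and "Q' = {2 powr (- real_of_int j) * of_int k'..<2 powr (- real_of_int j) * (of_int k' + 1)}"
    using assms(1,2) by (meson dyadic_eq)
  then show ?thesis using assms(3,4) dyadic_mem_iff by metis
qed

lemma dyadic_covers:
  obtains Q where "Q \<in> dyadic j" "x \<in> Q"
proof -
  let ?k = "\<lfloor>x * 2 powr real_of_int j\<rfloor>"
  let ?Q = "{2 powr (- real_of_int j) * of_int ?k..<2 powr (- real_of_int j) * (of_int ?k + 1)}"
  have "(2::real) powi (- j) = 2 powr (- real_of_int j)"
    using powr_real_of_int'[of 2 "- j"] by simp
  then have "?Q \<in> dyadic j" by (auto simp: dyadic_def)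
  moreover have "x \<in> ?Q" using dyadic_mem_iff[of ?Q j ?k x] by blast
  ultimately show ?thesis by (rule that)
qed

text \<open>Both endpoints of the block are multiples of 2^k, so they lie on the grid of this scale
  and the inclusion reduces to comparing integer indices.\<close>

lemma dyadic_subset_block:
  fixes M :: nat
  assumes Q: "Q \<in> dyadic (- int k)" and k: "k \<le> M" and x: "x \<in> Q" "x \<in> {2 ^ M..<2 ^ (M + 1)}"
  shows "Q \<subseteq> {2 ^ M..<2 ^ (M + 1)}"
proof -
  obtain i :: int where "Q = {2 powr (- real_of_int (- int k)) * of_int i..<2 powr (- real_of_int (- int k)) * (of_int i + 1)}"
    using Q by (rule dyadic_eq)
  then have i: "Q = {2 ^ k * of_int i..<2 ^ k * (of_int i + 1)}" by (simp add: powr_realpow)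
  have "2 ^ k * of_int (2 ^ (M - k)) = (2 ^ M :: real)" "2 ^ k * of_int (2 ^ (M + 1 - k)) = (2 ^ (M + 1) :: real)"
    using k by (simp_all flip: power_add)
  note pow = this
  have "2 ^ k * of_int (2 ^ (M - k)) < 2 ^ k * (of_int i + 1 :: real)"
    unfolding pow using x i by auto
  then have "real_of_int (2 ^ (M - k)) < of_int (i + 1)" by simp
  then have "2 ^ (M - k) \<le> i" by linarith
  then have "real_of_int (2 ^ (M - k)) \<le> of_int i" by linarith
  then have lower: "2 ^ M \<le> (2 ^ k * of_int i :: real)" unfolding pow(1)[symmetric] by simp
  have "2 ^ k * of_int i < (2 ^ k * of_int (2 ^ (M + 1 - k)) :: real)"
    unfolding pow using x i by auto
  then have "real_of_int i < of_int (2 ^ (M + 1 - k))" by simp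
  then have "i + 1 \<le> 2 ^ (M + 1 - k)" by linarith
  then have "of_int i + 1 \<le> real_of_int (2 ^ (M + 1 - k))" by linarith
  then have "(2 ^ k * (of_int i + 1) :: real) \<le> 2 ^ (M + 1)" unfolding pow(2)[symmetric] by simp
  then show ?thesis using lower unfolding i by auto
qed

lemma infsum_single:
  fixes f :: "'a \<Rightarrow> 'b::{comm_monoid_add, t2_space}"
  assumes "a \<in> A" "\<And>b. b \<in> A \<Longrightarrow> b \<noteq> a \<Longrightarrow> f b = 0"
  shows "infsum f A = f a"
proof -
  have "infsum f A = infsum f {a}"
    using assms by (intro infsum_cong_neutral) auto
  then show ?thesis by simp
qed

text \<open>The value type is general because the lemma collapses both the scalar sums in
  \<open>level\<close> and the \<open>ennreal\<close> sums in \<open>f_norm_average\<close>.\<close>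

lemma infsum_dyadic:
  fixes f :: "real set \<Rightarrow> 'b::{comm_monoid_add, t2_space}"
  assumes Q: "Q \<in> dyadic j" "x \<in> Q" and f: "\<And>Q. x \<notin> Q \<Longrightarrow> f Q = 0"
  shows "infsum f (dyadic j) = f Q"
proof (rule infsum_single[OF Q(1)])
  fix Q' assume "Q' \<in> dyadic j" "Q' \<noteq> Q"
  then have "x \<notin> Q'" using dyadic_mem_unique Q by blast
  then show "f Q' = 0" by (rule f)
qed

lemma nrm_ell_single:
  fixes c :: "'k::real_normed_field"
  assumes "u > 0"
  shows "nrm (ell u) (\<lambda>i. if i = k then c else 0) = norm c"
proof -
  have "(\<Sum>\<^sub>\<infinity>i. norm (if i = k then c else 0) powr u) = norm c powr u"
    by (subst infsum_single[of k]) auto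
  then show ?thesis using assms by (simp add: nrm_ell powr_powr)
qed

text \<open>As \<open>k\<close> runs from \<open>N\<^sup>2\<close> to \<open>(N + 1)\<^sup>2\<close>, \<open>sqrt k\<close> moves by one in
  steps of at most \<open>1 / (2 N)\<close>.\<close>

lemma exists_close_pole:
  fixes x :: real
  assumes N: "N \<ge> 1" and M: "M = (N + 1)\<^sup>2" and x: "x \<ge> 2 ^ M"
  obtains K a where "N\<^sup>2 \<le> K" "K \<le> M" "a \<in> poles K" "\<bar>x - a\<bar> \<le> 1 / (2 * real N)"
proof -
  define f where "f = frac (x - real N)"
  \<comment> \<open>The largest \<open>K\<close> with sqrt K \<le> N + f, where f is the fractional
    part that the pole has to match.\<close>
  define K where "K = nat \<lfloor>(real N + f)\<^sup>2\<rfloor>"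
  have f: "0 \<le> f" "f < 1" by (simp_all add: f_def frac_lt_1)
  have sq: "real (N\<^sup>2) \<le> (real N + f)\<^sup>2" "(real N + f)\<^sup>2 \<le> real M"
    using f by (auto simp: M intro!: power_mono)
  have K: "real K \<le> (real N + f)\<^sup>2" "(real N + f)\<^sup>2 < real K + 1" by (simp_all add: K_def)
  have KM: "N\<^sup>2 \<le> K" "K \<le> M"
  proof -
    have "real (N\<^sup>2) < real (K + 1)" using sq K by simp
    then show "N\<^sup>2 \<le> K" by linarith
    show "K \<le> M" using sq K by linarith
  qed
  have N_sqrt: "real N \<le> sqrt K" using KM(1) by (intro real_le_rsqrt) (metis of_nat_le_iff of_nat_power)
  have sqrt_le: "sqrt K \<le> real N + f" using K f by (intro real_le_lsqrt) auto
  \<comment> \<open>Difference of squares: N + f + sqrt K is at least 2N, while (N + f)^2 - K is at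
    most 1.\<close>
  have "(real N + f - sqrt K) * (2 * real N) \<le> (real N + f - sqrt K) * (real N + f + sqrt K)"
    using sqrt_le N_sqrt f by (intro mult_left_mono) auto
  also have "\<dots> = (real N + f)\<^sup>2 - real K" by (simp add: power2_eq_square algebra_simps flip: real_sqrt_mult)
  also have "\<dots> \<le> 1" using K by linarith
  finally have close: "real N + f - sqrt K \<le> 1 / (2 * real N)"
    using N by (simp add: pos_le_divide_eq)
  \<comment> \<open>As x = i + N + f, the candidate i + sqrt K misses x by N + f - sqrt K. It is a
    pole only if i \<ge> K, which follows from x \<ge> 2^M \<ge> 2M and N + 1 \<le> M.\<close>
  define i where "i = nat \<lfloor>x - real N\<rfloor>"
  have "N + 1 \<le> M" using N by (simp add: M power2_eq_square)
  have "2 * n \<le> 2 ^ n" if "1 \<le> n" for n :: nat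
    using that by (induction n rule: nat_induct_at_least) auto
  then have "2 * M \<le> 2 ^ M" using \<open>N + 1 \<le> M\<close> by simp
  have "real (2 * M) \<le> x" using \<open>2 * M \<le> 2 ^ M\<close> x by (metis numeral_power_le_of_nat_cancel_iff of_nat_le_iff of_nat_numeral of_nat_power order_trans)
  then have fl: "\<lfloor>x - real N\<rfloor> \<ge> int M" using \<open>N + 1 \<le> M\<close> by (simp add: le_floor_iff)
  then have "i \<ge> K" using KM(2) by (simp add: i_def le_nat_iff)
  then have "real i + sqrt K \<in> poles K" by (auto simp: poles_def)
  moreover have "x = real i + real N + f" using fl by (simp add: i_def f_def frac_def)
  then have "\<bar>x - (real i + sqrt K)\<bar> \<le> 1 / (2 * real N)" using close sqrt_le by simp
  ultimately show ?thesis using that KM by blast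
qed

text \<open>Far enough to the right for \<open>exists_close_pole\<close>, and itself a dyadic
  interval, hence tiled by those of every length 2^k with k \<le> (N + 1)^2.\<close>

definition block :: "nat \<Rightarrow> real set" where
  "block N = {2 ^ ((N + 1)\<^sup>2)..<2 ^ ((N + 1)\<^sup>2 + 1)}"

text \<open>The scalar factors cancel \<open>2\<^sup>j\<^sup>s\<close> and \<open>\<bar>Q\<bar>\<close> to the power \<open>-1/2\<close> in the norms, where
  \<open>j = -i\<close> is the level of \<open>Q\<close>.\<close>

definition test_seq :: "real \<Rightarrow> nat \<Rightarrow> real set \<Rightarrow> int \<Rightarrow> 'k::real_normed_field" where
  "test_seq s N Q = (\<lambda>i. if i \<in> {int (N\<^sup>2)..int ((N + 1)\<^sup>2)} \<and> Q \<subseteq> block N \<and> measure lebesgue Q = 2 powr i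
     then of_real (2 powr (of_int i * s) * 2 powr (of_int i / 2)) else 0)"

text \<open>The sequence sees \<open>Q\<close> only as a set; its measure recovers the level, and
  with it the single active coordinate -j.\<close>

lemma test_seq_dyadic:
  assumes "Q \<in> dyadic j"
  shows "test_seq s N Q = (\<lambda>i. if i = - j then
    (if - j \<in> {int (N\<^sup>2)..int ((N + 1)\<^sup>2)} \<and> Q \<subseteq> block N
     then of_real (2 powr (- of_int j * s) * 2 powr (- of_int j / 2)) else 0) else 0)"
proof -
  have "2 powr (- real_of_int j) = 2 powr real_of_int i \<longleftrightarrow> i = - j" for i :: int
    by (simp add: powr_inj) linarith
  then show ?thesis
    unfolding test_seq_def measure_dyadic[OF assms] by (auto simp: fun_eq_iff)
qed

lemma test_seq_in_ell: "Q \<in> dyadic j \<Longrightarrow> test_seq s N Q \<in> vecs (ell u)"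
  by (rule ell_finite_support) (simp add: test_seq_dyadic)

text \<open>The interval of this level around \<open>x\<close> stays inside the block, so a single
  multiple of the basis vector with index \<open>k\<close> is seen. Its factor 2^(k/2) cancels
  |Q|^(-1/2).\<close>

lemma nrm_diag_level:
  fixes c :: "int \<Rightarrow> real"
  assumes u: "u > 0" and k: "N\<^sup>2 \<le> k" "k \<le> (N + 1)\<^sup>2" and x: "x \<in> block N"
  shows "nrm (ell u) (diag c (level (test_seq s N :: _ \<Rightarrow> _ \<Rightarrow> 'k::real_normed_field) (- int k) x))
         = \<bar>c (int k)\<bar> * 2 powr (real k * s)"
proof -
  obtain Q where Q: "Q \<in> dyadic (- int k)" "x \<in> Q" by (rule dyadic_covers)
  have sub: "Q \<subseteq> block N"
    using dyadic_subset_block[OF Q(1) k(2) Q(2)] x by (simp add: block_def)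
  have kk: "int k \<in> {int (N\<^sup>2)..int ((N + 1)\<^sup>2)}"
    using k by (simp only: atLeastAtMost_iff of_nat_le_iff)
  have "level (test_seq s N) (- int k) x i
      = (if i = int k then of_real (2 powr (real k * s)) else (0 :: 'k))" for i
  proof -
    have "level (test_seq s N) (- int k) x i
        = test_seq s N Q i * of_real (measure lebesgue Q powr (- 1 / 2) * indicator Q x :: real)"
      unfolding level_def by (rule infsum_dyadic[OF Q]) simp
    also have "\<dots> = (if i = int k then
        of_real (2 powr (real k * s) * 2 powr (real k / 2) * ((2 powr real k) powr (- 1 / 2))) else (0 :: 'k))"
      using kk sub Q(2) unfolding test_seq_dyadic[OF Q(1)] measure_dyadic[OF Q(1)] by auto
    also have "2 powr (real k / 2) * ((2 powr real k) powr (- 1 / 2)) = 1"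
      by (simp add: powr_powr flip: powr_add)
    then have "2 powr (real k * s) * 2 powr (real k / 2) * ((2 powr real k) powr (- 1 / 2)) = 2 powr (real k * s)"
      by (simp add: mult.assoc)
    finally show ?thesis .
  qed
  then have "diag c (level (test_seq s N :: _ \<Rightarrow> _ \<Rightarrow> 'k) (- int k) x)
      = (\<lambda>i. if i = int k then of_real (c (int k) * 2 powr (real k * s)) else 0)"
    by (auto simp: diag_def)
  then show ?thesis using u by (simp only: nrm_ell_single norm_of_real) (simp add: abs_mult)
qed

section \<open>Bounds for the two norms of the test sequences\<close>

lemma emeasure_block: "emeasure lebesgue (block N) = ennreal (2 ^ ((N + 1)\<^sup>2))"
  by (simp add: block_def)

lemma block_sets [measurable]: "block N \<in> sets lebesgue"
  by (simp add: block_def)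

lemma Lp_qnorm_block:
  assumes "p > 0" "c \<ge> 0"
  shows "epowr (\<integral>\<^sup>+x. ennreal (c powr p) * indicator (block N) x \<partial>lebesgue) (1 / p)
         = ennreal (c * (2 ^ ((N + 1)\<^sup>2)) powr (1 / p))"
  using assms
  by (simp add: nn_integral_cmult_indicator emeasure_block ennreal_mult[symmetric] epowr_ennreal
      powr_mult powr_powr)

text \<open>Almost every point of the block has a pole of some active \<open>K\<close> within 1 /
  (2N). There \<open>bump K\<close> is at least N^(1/2), and level -K alone puts its m-th root into
  the supremum.\<close>

lemma f_norm_weight_ge:
  fixes s :: real
  assumes p: "p > 0" and u: "u > 0" and m: "m > 0" and N: "N \<ge> 1"
  shows "ennreal (real N powr (1 / (2 * m)) * (2 ^ ((N + 1)\<^sup>2)) powr (1 / p))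
    \<le> f_norm_weight (ell u) p s (\<lambda>x. diag (wt m x)) (test_seq s N :: _ \<Rightarrow> _ \<Rightarrow> 'k::real_normed_field)"
proof -
  let ?F = "\<lambda>x. SUP j::int. ennreal (2 powr (of_int j * s))
    * ennreal (nrm (ell u) (diag (wt m x) (level (test_seq s N :: _ \<Rightarrow> _ \<Rightarrow> 'k) j x)))"
  have "AE x in lebesgue. ennreal ((real N powr (1 / (2 * m))) powr p) * indicator (block N) x \<le> epowr (?F x) p"
    using AE_not_all_poles
  proof eventually_elim
    case (elim x)
    show ?case
    proof (cases "x \<in> block N")
      case True
      then have "x \<ge> 2 ^ ((N + 1)\<^sup>2)" by (simp add: block_def)
      then obtain K a where K: "N\<^sup>2 \<le> K" "K \<le> (N + 1)\<^sup>2" and a: "a \<in> poles K" "\<bar>x - a\<bar> \<le> 1 / (2 * real N)"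
        using exists_close_pole[OF N refl] by blast
      have nx: "x \<notin> poles K" using elim by (auto simp: all_poles_def)
      then have "\<bar>x - a\<bar> > 0" using a by auto
      then have "(1 / real N) powr (- (1/2)) \<le> (2 * \<bar>x - a\<bar>) powr (- (1/2))"
        using a(2) N by (intro powr_mono2') (auto simp: field_simps)
      also have "\<dots> \<le> bump K x" by (rule bump_ge_pole[OF a(1) nx])
      finally have "real N powr (1/2) \<le> bump K x"
        using N by (simp add: powr_minus powr_divide field_simps)
      then have "(real N powr (1/2)) powr (1 / m) \<le> wt m x (int K)"
        unfolding wt_def using m by (intro powr_mono2) auto
      then have "ennreal (real N powr (1 / (2 * m))) \<le> ennreal (wt m x (int K))"
        by (intro ennreal_leI) (simp add: powr_powr)
      also have "\<dots> = ennreal (2 powr (of_int (- int K) * s))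
          * ennreal (nrm (ell u) (diag (wt m x) (level (test_seq s N :: _ \<Rightarrow> _ \<Rightarrow> 'k) (- int K) x)))"
        unfolding nrm_diag_level[OF u K True] using wt_pos[OF m, of x "int K"]
        by (simp add: ennreal_mult[symmetric] powr_minus field_simps)
      also have "\<dots> \<le> ?F x" by (rule SUP_upper) simp
      finally have "epowr (ennreal (real N powr (1 / (2 * m)))) p \<le> epowr (?F x) p"
        using p by (intro epowr_mono) auto
      then show ?thesis using True by (simp add: epowr_ennreal)
    qed simp
  qed
  then have "(\<integral>\<^sup>+x. ennreal ((real N powr (1 / (2 * m))) powr p) * indicator (block N) x \<partial>lebesgue)
      \<le> (\<integral>\<^sup>+x. epowr (?F x) p \<partial>lebesgue)"
    by (rule nn_integral_mono_AE)
  then have "epowr (\<integral>\<^sup>+x. ennreal ((real N powr (1 / (2 * m))) powr p) * indicator (block N) x \<partial>lebesgue) (1 / p)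
      \<le> epowr (\<integral>\<^sup>+x. epowr (?F x) p \<partial>lebesgue) (1 / p)"
    using p by (intro epowr_mono) auto
  then show ?thesis
    unfolding f_norm_weight_def Lp_qnorm_def using p by (simp only: Lp_qnorm_block powr_ge_zero)
qed

text \<open>Each level uses one coordinate, and a single \<open>bump\<close> has bounded averages on
  the long intervals in question. So every level contributes at most 26 on the block and nothing
  outside, and the supremum obeys the same bound.\<close>

lemma f_norm_average_le:
  fixes s :: real
  assumes p: "p > 0" and u: "u \<ge> 1" "m \<ge> u" and r: "1 \<le> r" "r \<le> m"
  shows "f_norm_average (ell u) p s (rho (ell u) (\<lambda>x. diag (wt m x)) r)
      (test_seq s N :: _ \<Rightarrow> _ \<Rightarrow> 'k::real_normed_field)
    \<le> ennreal (26 * (2 ^ ((N + 1)\<^sup>2)) powr (1 / p))"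
proof -
  let ?t = "test_seq s N :: _ \<Rightarrow> _ \<Rightarrow> 'k"
  let ?\<rho> = "rho (ell u) (\<lambda>x. diag (wt m x) :: (int \<Rightarrow> 'k) \<Rightarrow> _) r"
  let ?G = "\<lambda>x. SUP j::int. ennreal (2 powr (of_int j * s)) *
       (\<Sum>\<^sub>\<infinity>Q\<in>dyadic j. ?\<rho> Q (?t Q) * ennreal (measure lebesgue Q powr (- 1 / 2)) * indicator Q x)"
  have u0: "u > 0" using u by simp
  have "?G x \<le> ennreal 26 * indicator (block N) x" for x
  proof (rule SUP_least)
    fix j :: int
    obtain Q where Q: "Q \<in> dyadic j" "x \<in> Q" by (rule dyadic_covers)
    let ?c = "if - j \<in> {int (N\<^sup>2)..int ((N + 1)\<^sup>2)} \<and> Q \<subseteq> block N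
      then 2 powr (- of_int j * s) * 2 powr (- of_int j / 2) else (0::real)"
    have t: "?t Q = (\<lambda>i. if i = - j then of_real ?c else 0)"
      unfolding test_seq_dyadic[OF Q(1)] by auto
    have "?\<rho> Q (?t Q) \<le> ennreal (26 * nrm (ell u) (diag (\<lambda>_. 1) (?t Q)))"
    proof (rule rho_diag_wt_le[OF u r bounded_interval_dyadic[OF Q(1)] test_seq_in_ell[OF Q(1)]])
      \<comment> \<open>A nonzero entry forces -j into the active range, hence the length of
        \<open>Q\<close> is at least 1 and the estimate for long intervals applies.\<close>
      fix k assume "?t Q k \<noteq> 0"
      then have "- j \<in> {int (N\<^sup>2)..int ((N + 1)\<^sup>2)}" unfolding t by (auto split: if_splits)
      then have "- j \<ge> 0" by (simp only: atLeastAtMost_iff) (meson of_nat_0_le_iff order_trans)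
      then have "2 powr 0 \<le> (2 powr (- real_of_int j) :: real)" by (intro powr_mono) auto
      then have "measure lebesgue Q \<ge> 1/4" by (simp add: measure_dyadic[OF Q(1)])
      then show "(\<integral>\<^sup>+y. ennreal (bump (nat \<bar>k\<bar>) y) * indicator Q y \<partial>lebesgue)
          \<le> ennreal (25 * measure lebesgue Q * 1 powr m)"
        using nn_integral_bump_le_long[OF bounded_interval_dyadic[OF Q(1)]] by simp
    qed auto
    also have "nrm (ell u) (diag (\<lambda>_. 1) (?t Q)) = ?c"
      unfolding diag_one t nrm_ell_single[OF u0] norm_of_real by simp
    finally have \<rho>: "?\<rho> Q (?t Q) \<le> ennreal (26 * ?c)" .
    have "(\<Sum>\<^sub>\<infinity>Q\<in>dyadic j. ?\<rho> Q (?t Q) * ennreal (measure lebesgue Q powr (- 1 / 2)) * indicator Q x)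
        = ?\<rho> Q (?t Q) * ennreal (measure lebesgue Q powr (- 1 / 2)) * indicator Q x"
      by (rule infsum_dyadic[OF Q]) simp
    then have "ennreal (2 powr (of_int j * s)) *
        (\<Sum>\<^sub>\<infinity>Q\<in>dyadic j. ?\<rho> Q (?t Q) * ennreal (measure lebesgue Q powr (- 1 / 2)) * indicator Q x)
      = ennreal (2 powr (of_int j * s)) * (?\<rho> Q (?t Q) * ennreal (2 powr (of_int j / 2)))"
      using Q by (simp add: measure_dyadic powr_powr)
    also have "\<dots> \<le> ennreal (2 powr (of_int j * s)) * (ennreal (26 * ?c) * ennreal (2 powr (of_int j / 2)))"
      by (intro mult_left_mono mult_right_mono \<rho>) auto
    also have "\<dots> = ennreal (26 * (2 powr (of_int j * s) * (?c * 2 powr (of_int j / 2))))"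
      by (simp only: ennreal_mult'[symmetric] ennreal_mult''[symmetric] powr_ge_zero) (simp add: mult_ac)
    also have "2 powr (of_int j * s) * (?c * 2 powr (of_int j / 2)) \<le> indicator (block N) x"
    proof (cases "- j \<in> {int (N\<^sup>2)..int ((N + 1)\<^sup>2)} \<and> Q \<subseteq> block N")
      case True
      then have "x \<in> block N" using Q(2) by blast
      moreover have "2 powr (of_int j * s) * (2 powr (- of_int j * s) * 2 powr (- of_int j / 2) * 2 powr (of_int j / 2)) = (1::real)"
        by (simp flip: powr_add)
      ultimately show ?thesis using True by simp
    next
      case False
      show ?thesis unfolding if_not_P[OF False] by simp
    qed
    then have "ennreal (26 * (2 powr (of_int j * s) * (?c * 2 powr (of_int j / 2))))
        \<le> ennreal (26 * indicator (block N) x)"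
      by (intro ennreal_leI mult_left_mono) auto
    also have "\<dots> = ennreal 26 * indicator (block N) x" by (simp add: ennreal_mult' ennreal_indicator)
    finally show "ennreal (2 powr (of_int j * s)) *
        (\<Sum>\<^sub>\<infinity>Q\<in>dyadic j. ?\<rho> Q (?t Q) * ennreal (measure lebesgue Q powr (- 1 / 2)) * indicator Q x)
      \<le> ennreal 26 * indicator (block N) x" .
  qed
  then have "epowr (?G x) p \<le> epowr (ennreal 26 * indicator (block N) x) p" for x
    using p by (intro epowr_mono) simp_all
  moreover have "epowr (ennreal 26 * indicator (block N) x) p = ennreal (26 powr p) * indicator (block N) x" for x
  proof (cases "x \<in> block N")
    case True
    then show ?thesis using epowr_ennreal[of 26 p] by simp
  next
    case False
    then show ?thesis by (simp add: epowr_def)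
  qed
  ultimately have "epowr (?G x) p \<le> ennreal (26 powr p) * indicator (block N) x" for x
    by (simp only:)
  then have "epowr (\<integral>\<^sup>+x. epowr (?G x) p \<partial>lebesgue) (1 / p)
      \<le> epowr (\<integral>\<^sup>+x. ennreal (26 powr p) * indicator (block N) x \<partial>lebesgue) (1 / p)"
    using p by (intro epowr_mono nn_integral_mono) auto
  then show ?thesis
    unfolding f_norm_average_def Lp_qnorm_def using p by (simp add: Lp_qnorm_block)
qed

section \<open>Comparison of the two norms for large N\<close>

theorem proposition14p13:
  fixes p r s u :: real
  assumes "p > 0" and "r \<ge> 1" and "max p r > 1" and "u \<ge> 1"
  shows "\<exists>V :: (int, 'k::{real_normed_field, banach}) op_field.
           A_class (ell u) (max p r) V \<and>
           \<not> (\<exists>C::real. \<forall>t :: real set \<Rightarrow> int \<Rightarrow> 'k.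
                (\<forall>Q\<in>(\<Union>j. dyadic j). t Q \<in> vecs (ell u)) \<longrightarrow>
                f_norm_weight (ell u) p s V t
                  \<le> ennreal C * f_norm_average (ell u) p s (rho (ell u) V r) t)"
proof (intro exI conjI notI)
  \<comment> \<open>Jensen's inequality needs m \<ge> u, the averages of order r need m \<ge> r, and
    the A condition needs m \<ge> max p r.\<close>
  define m where "m = max u (max p r)"
  have m: "m \<ge> u" "r \<le> m" "max p r \<le> m" "m > 0" using assms by (auto simp: m_def)
  let ?V = "\<lambda>x. diag (wt m x) :: (int \<Rightarrow> 'k) \<Rightarrow> _"
  show "A_class (ell u) (max p r) ?V"
    by (rule A_class_diag_wt[OF assms(4) m(1) assms(3) m(3)])
  assume "\<exists>C::real. \<forall>t :: real set \<Rightarrow> int \<Rightarrow> 'k.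
      (\<forall>Q\<in>(\<Union>j. dyadic j). t Q \<in> vecs (ell u)) \<longrightarrow>
      f_norm_weight (ell u) p s ?V t \<le> ennreal C * f_norm_average (ell u) p s (rho (ell u) ?V r) t"
  then obtain C where C: "\<forall>t :: real set \<Rightarrow> int \<Rightarrow> 'k.
      (\<forall>Q\<in>(\<Union>j. dyadic j). t Q \<in> vecs (ell u)) \<longrightarrow>
      f_norm_weight (ell u) p s ?V t \<le> ennreal C * f_norm_average (ell u) p s (rho (ell u) ?V r) t"
    by (rule exE)
  \<comment> \<open>\<open>ennreal\<close> sends negative numbers to 0, so C may be replaced by its
    positive part before returning to real arithmetic.\<close>
  define C' where "C' = max 0 C"
  \<comment> \<open>The size of the block enters both norms through the same factor
    \<open>?R\<close> and cancels. What remains is N^(1/(2m)) \<le> 26 C', which this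
    \<open>N\<close> violates.\<close>
  obtain N :: nat where N: "(26 * C' + 1) powr (2 * m) \<le> real N"
    using real_arch_simple by blast
  have "(1::real) \<le> (26 * C' + 1) powr (2 * m)"
    using m(4) by (intro ge_one_powr_ge_zero) (auto simp: C'_def)
  then have N1: "N \<ge> 1" using N by linarith
  let ?R = "(2 ^ ((N + 1)\<^sup>2)) powr (1 / p) :: real"
  have R: "?R > 0" by simp
  have "ennreal (real N powr (1 / (2 * m)) * ?R) \<le> f_norm_weight (ell u) p s ?V (test_seq s N)"
    using assms m N1 by (intro f_norm_weight_ge) auto
  also have "\<dots> \<le> ennreal C * f_norm_average (ell u) p s (rho (ell u) ?V r) (test_seq s N)"
    by (rule C[rule_format]) (auto intro: test_seq_in_ell)
  also have "\<dots> \<le> ennreal C' * ennreal (26 * ?R)"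
    using assms m by (intro mult_mono f_norm_average_le ennreal_leI) (auto simp: C'_def)
  also have "\<dots> = ennreal (C' * (26 * ?R))"
    by (simp add: ennreal_mult C'_def)
  finally have "real N powr (1 / (2 * m)) * ?R \<le> C' * (26 * ?R)"
    by (subst (asm) ennreal_le_iff) (auto simp: C'_def)
  then have "real N powr (1 / (2 * m)) * ?R \<le> (26 * C') * ?R" by (simp only: mult_ac)
  then have "real N powr (1 / (2 * m)) \<le> 26 * C'" using R by (simp only: mult_le_cancel_right_pos)
  moreover have "((26 * C' + 1) powr (2 * m)) powr (1 / (2 * m)) \<le> real N powr (1 / (2 * m))"
    using N m(4) by (intro powr_mono2) auto
  then have "26 * C' + 1 \<le> real N powr (1 / (2 * m))"
    using m(4) by (simp add: powr_powr C'_def)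
  ultimately show False by linarith
qed

end
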